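(* Let $q\in(-1,1)$, $0<|\rho|<1$ and $x,y\in\left[-\frac{2}{\sqrt{1-q}},\frac{2}{\sqrt{1-q}}\right]$. Then $$f_{CN}(x|y,\rho,q)=f_U(x|q)\left(1+\sum_{k=1}^{\infty}\gamma_k(y,\rho,q)\,U_k\!\left(x\sqrt{1-q}/2\right)\right),$$ where $$\gamma_k(y,\rho,q)=\sum_{j=0}^{\lfloor k/2\rfloor}(-1)^j(1-q)^{k/2-j}q^{j(j+1)/2}\begin{bmatrix} k-j\\ k-2j\end{bmatrix}_q\rho^{k-2j}H_{k-2j}(y|q).$$
   Context: Notation: $[0]_q=0$, $[n]_q=1+q+\dots+q^{n-1}$, $[n]_q!=\prod_{i=1}^n[i]_q$, $[0]_q!=1$, $\begin{bmatrix} n\\ k\end{bmatrix}_q=\frac{[n]_q!}{[n-k]_q![k]_q!}$ if $n\ge k\ge0$ and $0$ otherwise; $(a)_\infty=\prod_{i\ge0}(1-aq^i)$; $0^0=1$. The densities are $$f_{CN}(x|y,\rho,q)=\frac{\sqrt{1-q}\,(\rho^2)_\infty(q)_\infty}{2\pi\sqrt{4-(1-q)x^2}}\prod_{k=0}^\infty\frac{(1+q^k)^2-(1-q)x^2q^k}{(1-\rho^2q^{2k})^2-(1-q)\rho q^k(1+\rho^2q^{2k})xy+(1-q)\rho^2(x^2+y^2)q^{2k}}$$ (at the endpoints $x=\pm2/\sqrt{1-q}$ understood by continuity, i.e. equal to $0$, since the $k=0$ numerator factor is $4-(1-q)x^2$), and $f_U(x|q)=\frac{1}{2\pi}\sqrt{(1-q)(4-(1-q)x^2)}$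 for $|x|\le2/\sqrt{1-q}$. $q$-Hermite polynomials: $H_{-1}(x|q)=0$, $H_0(x|q)=1$, $H_{n+1}(x|q)=xH_n(x|q)-[n]_qH_{n-1}(x|q)$. Chebyshev polynomials of the second kind: $U_{-1}=0$, $U_0=1$, $2xU_n(x)=U_{n+1}(x)+U_{n-1}(x)$. *)

theory Defs
  imports "HOL-Analysis.Infinite_Products"
begin

definition q_int :: "real \<Rightarrow> nat \<Rightarrow> real" where
  "q_int q n = (\<Sum>i<n. q ^ i)"

definition q_fact :: "real \<Rightarrow> nat \<Rightarrow> real" where
  "q_fact q n = (\<Prod>i=1..n. q_int q i)"

definition q_binomial :: "real \<Rightarrow> nat \<Rightarrow> nat \<Rightarrow> real" where
  "q_binomial q n k =
     (if k \<le> n then q_fact q n / (q_fact q (n - k) * q_fact q k) else 0)"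

definition q_poch_inf :: "real \<Rightarrow> real \<Rightarrow> real" where
  "q_poch_inf q a = (\<Prod>i. 1 - a * q ^ i)"

text \<open>In the next two recursions the convention that the polynomial of index $-1$ vanishes
  is built into the equation for index 1.\<close>

fun q_hermite :: "real \<Rightarrow> nat \<Rightarrow> real \<Rightarrow> real" where
  "q_hermite q 0 x = 1"
| "q_hermite q (Suc 0) x = x"
| "q_hermite q (Suc (Suc n)) x =
     x * q_hermite q (Suc n) x - q_int q (Suc n) * q_hermite q n x"

fun cheb_U :: "nat \<Rightarrow> real \<Rightarrow> real" where
  "cheb_U 0 x = 1"
| "cheb_U (Suc 0) x = 2 * x"
| "cheb_U (Suc (Suc n)) x = 2 * x * cheb_U (Suc n) x - cheb_U n x"

text \<open>Both densities are given by their formulas on the interval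
  $|x| \le 2/\sqrt{1-q}$ and are only meant to be used there. At the two endpoints the prefactor
  of \<open>f_CN\<close> is a division by 0, which is 0 in HOL; this agrees with the value 0
  obtained by continuous extension, as the factor of index 0 in the product contains
  $4 - (1-q)x^2$.\<close>

definition f_CN :: "real \<Rightarrow> real \<Rightarrow> real \<Rightarrow> real \<Rightarrow> real" where
  "f_CN x y \<rho> q =
     sqrt (1 - q) * q_poch_inf q (\<rho>\<^sup>2) * q_poch_inf q q
       / (2 * pi * sqrt (4 - (1 - q) * x\<^sup>2))
     * (\<Prod>k. ((1 + q ^ k)\<^sup>2 - (1 - q) * x\<^sup>2 * q ^ k)
            / ((1 - \<rho>\<^sup>2 * q ^ (2 * k))\<^sup>2
               - (1 - q) * \<rho> * q ^ k * (1 + \<rho>\<^sup>2 * q ^ (2 * k)) * x * y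
               + (1 - q) * \<rho>\<^sup>2 * (x\<^sup>2 + y\<^sup>2) * q ^ (2 * k)))"

definition f_U :: "real \<Rightarrow> real \<Rightarrow> real" where
  "f_U x q = 1 / (2 * pi) * sqrt ((1 - q) * (4 - (1 - q) * x\<^sup>2))"

definition gamma_coeff :: "nat \<Rightarrow> real \<Rightarrow> real \<Rightarrow> real \<Rightarrow> real" where
  "gamma_coeff k y \<rho> q =
     (\<Sum>j=0..k div 2. (-1) ^ j * (1 - q) powr (real k / 2 - real j) * q ^ (j * (j + 1) div 2)
        * q_binomial q (k - j) (k - 2 * j) * \<rho> ^ (k - 2 * j) * q_hermite q (k - 2 * j) y)"

end

theory Submission
  imports Defs
begin

text \<open>Put \<open>x = 2 cos t / sqrt (1 - q)\<close>, \<open>y = 2 cos s / sqrt (1 - q)\<close> and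
  \<open>h n = (1 - q) powr (n / 2) * q_hermite q n y\<close>. Grouping the terms of the Chebyshev series by the
  exponent \<open>n\<close> of \<open>\<rho>\<close> (so \<open>k = n + 2 j\<close>) turns it into \<open>S(\<rho>) = \<Sum>n. h n * a n * \<rho> ^ n\<close>, where
  \<open>a n = \<Sum>j. (-1) ^ j * q ^ (j (j + 1) / 2) * [n + j, n] * U (n + 2 j)\<close>. The coefficients satisfy
  \<open>(1 - q ^ n) a n = 2 cos t * a (n - 1) - a (n - 2)\<close>, which together with the recurrence of \<open>h\<close>
  yields a recurrence of order four for \<open>h n * a n\<close>, equivalent to the q-difference equation
  \<open>P(\<rho>) S(\<rho>) = (1 - \<rho>\<^sup>2) (1 - q \<rho>\<^sup>2) S(q \<rho>)\<close>, with \<open>P(\<rho> q ^ k)\<close> the \<open>k\<close>-th denominator factor of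
  the density. Iteration gives \<open>S(\<rho>) = (\<rho>\<^sup>2; q) / (\<Prod>k. P(\<rho> q ^ k)) * a 0\<close>, and \<open>a 0\<close> is the product of
  the numerator factors of index \<open>k \<ge> 1\<close> times \<open>(q; q)\<close> by the Jacobi triple product.\<close>

subsection \<open>q-binomial coefficients for \<open>\<bar>q\<bar> < 1\<close>\<close>

lemma q_int_eq: "(1 - q) * q_int q n = 1 - q ^ n"
  unfolding q_int_def by (simp add: one_diff_power_eq)

lemma one_minus_power_nonzero:
  fixes q :: real
  assumes "\<bar>q\<bar> < 1"
  shows "1 - q ^ Suc n \<noteq> 0"
proof -
  have "\<bar>q ^ Suc n\<bar> < 1"
    unfolding power_abs using power_less_one_iff[of "\<bar>q\<bar>" "Suc n"] assms by simp
  then show ?thesis by auto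
qed

lemma q_fact_Suc: "q_fact q (Suc n) = q_fact q n * q_int q (Suc n)"
  unfolding q_fact_def by simp

lemma q_fact_nonzero: "\<bar>q\<bar> < 1 \<Longrightarrow> q_fact q n \<noteq> 0"
proof (induction n)
  case (Suc n)
  have "q_int q (Suc n) \<noteq> 0"
    using q_int_eq[of q "Suc n"] one_minus_power_nonzero[OF Suc.prems, of n] by auto
  with Suc show ?case by (simp add: q_fact_Suc)
qed (simp add: q_fact_def)

text \<open>Turns q-factorials into partial products of \<open>q_poch_inf q q\<close>, so that
  bounds and limits of q-binomials follow from the convergence of that product.\<close>

lemma q_fact_eq_prod: "(1 - q) ^ n * q_fact q n = (\<Prod>i<n. 1 - q * q ^ i)"
proof (induction n)
  case (Suc n)
  have "(1 - q) ^ Suc n * q_fact q (Suc n) = ((1 - q) ^ n * q_fact q n) * ((1 - q) * q_int q (Suc n))"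
    by (simp add: q_fact_Suc mult_ac)
  then show ?case by (simp only: Suc q_int_eq) simp
qed (simp add: q_fact_def)

lemma q_binomial_0_right [simp]: "\<bar>q\<bar> < 1 \<Longrightarrow> q_binomial q n 0 = 1"
  by (simp add: q_binomial_def q_fact_nonzero q_fact_def[of q 0])

lemma q_binomial_diag [simp]: "\<bar>q\<bar> < 1 \<Longrightarrow> q_binomial q n n = 1"
  by (simp add: q_binomial_def q_fact_nonzero q_fact_def[of q 0])

lemma q_binomial_absorb:
  assumes "\<bar>q\<bar> < 1"
  shows "(1 - q ^ Suc m) * q_binomial q (Suc n) (Suc m) = (1 - q ^ Suc n) * q_binomial q n m"
proof (cases "m \<le> n")
  case True
  then have "Suc n - Suc m = n - m" "Suc m \<le> Suc n" by auto
  moreover have "1 - q \<noteq> 0" using assms by auto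
  moreover have "q_int q (Suc m) \<noteq> 0"
    using q_int_eq[of q "Suc m"] one_minus_power_nonzero[OF assms, of m] by auto
  ultimately show ?thesis
    using True q_fact_nonzero[OF assms]
    by (simp add: q_binomial_def q_fact_Suc flip: q_int_eq del: power_Suc)
qed (simp add: q_binomial_def)

lemma q_binomial_symmetric: "m \<le> n \<Longrightarrow> q_binomial q n (n - m) = q_binomial q n m"
  by (simp add: q_binomial_def mult.commute)

text \<open>The first q-Pascal rule. Over a common denominator it is the splitting
  \<open>[n + 1] = [m + 1] + q ^ (m + 1) * [n - m]\<close> of q-integers.\<close>

lemma q_binomial_Suc_Suc:
  assumes q: "\<bar>q\<bar> < 1"
  shows "q_binomial q (Suc n) (Suc m) = q_binomial q n m + q ^ Suc m * q_binomial q n (Suc m)"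
proof -
  consider "m < n" | "m = n" | "n < m" by linarith
  then show ?thesis
  proof cases
    case 1
    then obtain k where n: "n = Suc (m + k)" using less_imp_Suc_add by blast
    have "1 - q \<noteq> 0" using q by auto
    have split: "q_int q (Suc (Suc (m + k))) = q_int q (Suc m) + q ^ Suc m * q_int q (Suc k)"
    proof -
      have "(1 - q) * q_int q (Suc (Suc (m + k))) = (1 - q) * (q_int q (Suc m) + q ^ Suc m * q_int q (Suc k))"
        unfolding distrib_left mult.left_commute[of "1 - q"] q_int_eq
        by (simp add: algebra_simps power_add)
      then show ?thesis using \<open>1 - q \<noteq> 0\<close> by simp
    qed
    have nz: "q_int q (Suc i) \<noteq> 0" for i
      using q_int_eq[of q "Suc i"] one_minus_power_nonzero[OF q, of i] by auto
    have 1: "q_binomial q (Suc n) (Suc m) = q_fact q n * q_int q (Suc (Suc (m + k))) / (q_fact q (Suc k) * q_fact q (Suc m))"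
      by (simp add: q_binomial_def n q_fact_Suc Suc_diff_le)
    have 2: "q_binomial q n m = q_fact q n * q_int q (Suc m) / (q_fact q (Suc k) * q_fact q (Suc m))"
      by (simp add: q_binomial_def n q_fact_Suc[of q m] Suc_diff_le nz)
    have 3: "q_binomial q n (Suc m) = q_fact q n * q_int q (Suc k) / (q_fact q (Suc k) * q_fact q (Suc m))"
      by (simp add: q_binomial_def n q_fact_Suc[of q k] Suc_diff_le nz)
    show ?thesis unfolding 1 2 3 split by (simp add: field_simps add_divide_distrib)
  qed (use q in \<open>auto simp: q_binomial_def q_fact_nonzero\<close>)
qed

text \<open>The second q-Pascal rule, the mirror image of the first under passing to the
  complementary lower index.\<close>

lemma q_binomial_Suc_Suc':
  assumes q: "\<bar>q\<bar> < 1" and "m \<le> n"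
  shows "q_binomial q (Suc n) (Suc m) = q_binomial q n (Suc m) + q ^ (n - m) * q_binomial q n m"
proof (cases "m = n")
  case True
  then show ?thesis using q by (simp add: q_binomial_def[of q n "Suc n"])
next
  case False
  with \<open>m \<le> n\<close> obtain k where n: "n = Suc (m + k)" by (metis le_neq_implies_less less_imp_Suc_add)
  have "q_binomial q (Suc n) (Suc m) = q_binomial q (Suc n) (Suc k)"
    using q_binomial_symmetric[of "Suc m" "Suc n" q] by (simp add: n Suc_diff_le)
  also have "\<dots> = q_binomial q n k + q ^ Suc k * q_binomial q n (Suc k)"
    by (rule q_binomial_Suc_Suc[OF q])
  also have "q_binomial q n k = q_binomial q n (Suc m)"
    using q_binomial_symmetric[of "Suc m" n q] by (simp add: n)
  also have "q_binomial q n (Suc k) = q_binomial q n m"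
    using q_binomial_symmetric[of m n q] by (simp add: n Suc_diff_le)
  finally show ?thesis by (simp add: n Suc_diff_le)
qed

subsection \<open>Infinite products and bounds\<close>

text \<open>A geometrically small deviation from 1 is absolutely summable, hence the product
  converges absolutely. The q-Pochhammer, numerator and denominator products are all controlled this
  way.\<close>

lemma
  fixes f :: "nat \<Rightarrow> real"
  assumes "\<And>i. \<bar>f i - 1\<bar> \<le> C * \<bar>q\<bar> ^ i" and "\<bar>q\<bar> < 1"
  shows convergent_prod_geometric: "convergent_prod f"
    and tendsto_prodinf_geometric: "(\<lambda>n. \<Prod>i<n. f i) \<longlonglongrightarrow> prodinf f"
proof -
  have "summable (\<lambda>i. norm (f i - 1))"
  proof (rule summable_comparison_test')
    show "summable (\<lambda>i. C * \<bar>q\<bar> ^ i)" using assms(2) by (intro summable_mult summable_geometric) auto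
  qed (use assms(1) in auto)
  then show "convergent_prod f"
    by (intro abs_convergent_prod_imp_convergent_prod summable_imp_abs_convergent_prod)
  from convergent_prod_LIMSEQ[OF this]
  have "(\<lambda>n. \<Prod>i<Suc n. f i) \<longlonglongrightarrow> prodinf f" by (simp add: lessThan_Suc_atMost)
  then show "(\<lambda>n. \<Prod>i<n. f i) \<longlonglongrightarrow> prodinf f"
    by (rule LIMSEQ_imp_Suc)
qed

lemma q_poch_inf_tendsto:
  assumes "\<bar>q\<bar> < 1"
  shows "(\<lambda>n. \<Prod>i<n. 1 - a * q ^ i) \<longlonglongrightarrow> q_poch_inf q a"
  unfolding q_poch_inf_def
  by (rule tendsto_prodinf_geometric[OF _ assms, where C = "\<bar>a\<bar>"]) (simp add: abs_mult power_abs)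

lemma q_poch_inf_self_nonzero:
  assumes "\<bar>q\<bar> < 1"
  shows "q_poch_inf q q \<noteq> 0"
  unfolding q_poch_inf_def
proof (rule prodinf_nonzero)
  show "convergent_prod (\<lambda>i. 1 - q * q ^ i)"
    by (rule convergent_prod_geometric[OF _ assms, where C = "\<bar>q\<bar>"]) (simp add: abs_mult power_abs)
  show "1 - q * q ^ i \<noteq> 0" for i using one_minus_power_nonzero[OF assms, of i] by simp
qed

lemma q_binomial_eq_prod:
  assumes "k \<le> n" "\<bar>q\<bar> < 1"
  shows "q_binomial q n k = (\<Prod>i<n. 1 - q * q ^ i) * inverse (\<Prod>i<n - k. 1 - q * q ^ i)
           * inverse (\<Prod>i<k. 1 - q * q ^ i)"
proof -
  have "(1 - q) ^ n = (1 - q) ^ (n - k) * (1 - q) ^ k"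
    using \<open>k \<le> n\<close> by (simp flip: power_add)
  moreover have "1 - q \<noteq> 0" using assms by auto
  ultimately show ?thesis
    using assms(1) by (simp add: q_binomial_def field_simps flip: q_fact_eq_prod)
qed

text \<open>A q-binomial is a quotient of partial products of \<open>q_poch_inf q q\<close>. These
  converge to a nonzero limit, so both they and their inverses are bounded, uniformly in the two
  indices.\<close>

lemma q_binomial_bounded:
  assumes "\<bar>q\<bar> < 1"
  obtains C where "C \<ge> 0" "\<And>n k. \<bar>q_binomial q n k\<bar> \<le> C"
proof -
  let ?p = "\<lambda>n. \<Prod>i<n. 1 - q * q ^ i"
  note lim = q_poch_inf_tendsto[OF assms, of q]
  have "Bseq ?p" using lim by (rule convergent_imp_Bseq[OF convergentI])
  then obtain A where A: "\<And>n. \<bar>?p n\<bar> \<le> A" "A > 0" unfolding Bseq_def by auto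
  have "Bseq (\<lambda>n. inverse (?p n))"
    by (rule convergent_imp_Bseq[OF convergentI])
       (rule tendsto_inverse[OF lim q_poch_inf_self_nonzero[OF assms]])
  then obtain B where B: "\<And>n. \<bar>inverse (?p n)\<bar> \<le> B" "B > 0" unfolding Bseq_def real_norm_def by blast
  have "\<bar>q_binomial q n k\<bar> \<le> A * B * B" for n k
  proof (cases "k \<le> n")
    case True
    have "\<bar>?p n\<bar> * \<bar>inverse (?p (n - k))\<bar> * \<bar>inverse (?p k)\<bar> \<le> A * B * B"
      by (intro mult_mono A B mult_nonneg_nonneg order.strict_implies_order[OF A(2)]
            order.strict_implies_order[OF B(2)] abs_ge_zero)
    then show ?thesis using q_binomial_eq_prod[OF True assms] by (simp add: abs_mult)
  qed (use A(2) B(2) in \<open>simp add: q_binomial_def\<close>)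
  then show thesis using A(2) B(2) that[of "A * B * B"] by auto
qed

text \<open>All three partial products become infinitely long, one in the numerator and two in the
  denominator, which leaves one inverse. This limit carries the finite triple product over to the
  theta series.\<close>

lemma q_binomial_central_tendsto:
  assumes "\<bar>q\<bar> < 1"
  shows "(\<lambda>N. q_binomial q (2 * N + 1) (N - j)) \<longlonglongrightarrow> inverse (q_poch_inf q q)"
proof -
  let ?p = "\<lambda>n. \<Prod>i<n. 1 - q * q ^ i"
  note lim = q_poch_inf_tendsto[OF assms, of q]
  note nz = q_poch_inf_self_nonzero[OF assms]
  have 1: "filterlim (\<lambda>N. 2 * N + 1) at_top (sequentially :: nat filter)"
    by (rule filterlim_at_top_mono[OF filterlim_ident]) (auto intro: eventuallyI)
  have 2: "filterlim (\<lambda>N. N - j) at_top (sequentially :: nat filter)"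
    by (rule filterlim_minus_const_nat_at_top)
  have 3: "filterlim (\<lambda>N. 2 * N + 1 - (N - j)) at_top (sequentially :: nat filter)"
    by (rule filterlim_at_top_mono[OF filterlim_ident]) (auto intro: eventuallyI)
  have "(\<lambda>N. ?p (2 * N + 1) * inverse (?p (2 * N + 1 - (N - j))) * inverse (?p (N - j)))
    \<longlonglongrightarrow> q_poch_inf q q * inverse (q_poch_inf q q) * inverse (q_poch_inf q q)"
    by (intro tendsto_mult tendsto_inverse nz filterlim_compose[OF lim 1]
          filterlim_compose[OF lim 2] filterlim_compose[OF lim 3])
  moreover have "?p (2 * N + 1) * inverse (?p (2 * N + 1 - (N - j))) * inverse (?p (N - j))
     = q_binomial q (2 * N + 1) (N - j)" for N
    by (rule q_binomial_eq_prod[symmetric, OF _ assms]) simp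
  ultimately show ?thesis using nz by simp
qed

section \<open>Convergence and growth estimates\<close>

lemma summable_square_times_geometric:
  fixes r :: real
  assumes "\<bar>r\<bar> < 1"
  shows "summable (\<lambda>n. (real n + 1)\<^sup>2 * \<bar>r\<bar> ^ n)"
proof (rule summable_comparison_test')
  \<comment> \<open>Differentiating the geometric series twice gives the coefficients
    \<open>(n + 1) * (n + 2)\<close>, which dominate the squares.\<close>
  have "summable (\<lambda>n. diffs (\<lambda>_. 1 :: real) n * x ^ n)" if "norm x < 1" for x
    by (rule termdiff_converges[where K = 1]) (use that in \<open>auto intro: summable_geometric\<close>)
  then show "summable (\<lambda>n. diffs (diffs (\<lambda>_. 1)) n * \<bar>r\<bar> ^ n)"
    by (intro termdiff_converges[where K = 1]) (use assms in auto)
  show "norm ((real n + 1)\<^sup>2 * \<bar>r\<bar> ^ n) \<le> diffs (diffs (\<lambda>_. 1)) n * \<bar>r\<bar> ^ n" for n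
    by (auto simp: diffs_def power2_eq_square abs_mult mult.commute intro!: mult_right_mono mult_mono)
qed

text \<open>The differences \<open>v (n + 1) - cis t * v n\<close> are rotated by \<open>cis (- t)\<close> in each step, up to the
  error \<open>e n * v n\<close>.\<close>

lemma perturbed_chebyshev_bound:
  fixes v e :: "nat \<Rightarrow> real"
  assumes v0: "v 0 = 1" and v1: "v (Suc 0) = 2 * cos t"
    and v2: "\<And>n. v (Suc (Suc n)) = 2 * cos t * v (Suc n) - (1 - e n) * v n"
    and e: "\<And>n. \<bar>e n\<bar> \<le> Q ^ Suc n" and Q: "Q \<ge> 0"
  shows "\<bar>v n\<bar> \<le> (real n + 1) * (\<Prod>i<n. 1 + (real i + 1) * Q ^ Suc i)"
proof -
  define K where "K n = (\<Prod>i<n. 1 + (real i + 1) * Q ^ Suc i)" for n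
  define u where "u n = complex_of_real (v (Suc n)) - cis t * of_real (v n)" for n
  have KSuc: "K (Suc n) = K n * (1 + (real n + 1) * Q ^ Suc n)" for n by (simp add: K_def)
  have Kpos: "K n > 0" for n
    unfolding K_def by (intro prod_pos ballI add_pos_nonneg mult_nonneg_nonneg zero_le_power Q) auto
  have Kmono: "K n \<le> K (Suc n)" for n
    using Kpos[of n] Q by (simp add: KSuc)
  have cos: "complex_of_real (2 * cos t) = cis t + cnj (cis t)"
    by (simp add: complex_eq_iff)
  have cis: "cnj (cis t) * cis t = 1"
    by (simp add: cis_cnj cis_mult)
  have uSuc: "u (Suc n) = cnj (cis t) * u n + of_real (e n * v n)" for n
  proof -
    have "u (Suc n) = of_real (2 * cos t) * of_real (v (Suc n)) - (1 - of_real (e n)) * of_real (v n)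
        - cis t * of_real (v (Suc n))"
      by (simp add: u_def v2)
    also have "\<dots> = cnj (cis t) * of_real (v (Suc n)) - (cnj (cis t) * cis t) * of_real (v n)
        + of_real (e n * v n)"
      unfolding cos cis by (simp add: algebra_simps)
    finally show ?thesis by (simp add: u_def algebra_simps)
  qed
  \<comment> \<open>The two bounds need each other: \<open>v\<close> grows by at most
    \<open>norm (u n)\<close> per step, while the error added to \<open>u\<close> is a multiple of
    \<open>v\<close>. The factors of \<open>K\<close> are chosen to absorb exactly that
    error.\<close>
  have "\<bar>v n\<bar> \<le> (real n + 1) * K n \<and> norm (u n) \<le> K n"
  proof (induction n)
    case 0
    have "u 0 = cnj (cis t)" by (simp add: u_def v0 v1 cos[simplified] del: cis_cnj)
    then show ?case by (simp add: v0 K_def)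
  next
    case (Suc n)
    have "\<bar>v (Suc n)\<bar> = norm (u n + cis t * of_real (v n))" by (simp add: u_def)
    also have "\<dots> \<le> norm (u n) + \<bar>v n\<bar>" by (rule norm_triangle_le) (simp add: norm_mult)
    also have "\<dots> \<le> (real n + 2) * K n" using Suc by (simp add: algebra_simps)
    also have "\<dots> \<le> (real n + 2) * K (Suc n)" by (intro mult_left_mono Kmono) auto
    finally have 1: "\<bar>v (Suc n)\<bar> \<le> (real (Suc n) + 1) * K (Suc n)" by (simp add: algebra_simps)
    have "norm (u (Suc n)) \<le> norm (u n) + \<bar>e n\<bar> * \<bar>v n\<bar>"
      unfolding uSuc by (rule norm_triangle_le) (simp add: norm_mult abs_mult)
    also have "\<dots> \<le> K n + Q ^ Suc n * ((real n + 1) * K n)"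
      using Suc e[of n] Q by (intro add_mono mult_mono) auto
    also have "\<dots> = K (Suc n)" by (simp add: KSuc algebra_simps)
    finally show ?case using 1 by simp
  qed
  then show ?thesis by (simp add: K_def)
qed

text \<open>For the error \<open>q ^ Suc n\<close> the product in the preceding bound converges, so
  only the linear factor remains. The rescaled q-Hermite polynomials are of this type.\<close>

lemma perturbed_chebyshev_linear_growth:
  fixes v :: "nat \<Rightarrow> real"
  assumes "v 0 = 1" "v (Suc 0) = 2 * cos t"
    and "\<And>n. v (Suc (Suc n)) = 2 * cos t * v (Suc n) - (1 - q ^ Suc n) * v n"
    and q: "\<bar>q\<bar> < 1"
  obtains C where "C > 0" "\<And>n. \<bar>v n\<bar> \<le> C * (real n + 1)"
proof -
  let ?f = "\<lambda>i. 1 + (real i + 1) * \<bar>q\<bar> ^ Suc i"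
  have "summable (\<lambda>i. norm (?f i - 1))"
  proof (rule summable_comparison_test'[OF summable_square_times_geometric[OF q]])
    show "norm (norm (?f n - 1)) \<le> (real n + 1)\<^sup>2 * \<bar>q\<bar> ^ n" for n
    proof -
      have "(real n + 1) * \<bar>q\<bar> ^ Suc n = (real n + 1) * (\<bar>q\<bar> * \<bar>q\<bar> ^ n)" by simp
      also have "\<dots> \<le> (real n + 1) * ((real n + 1) * \<bar>q\<bar> ^ n)"
        by (intro mult_left_mono mult_right_mono) (use q in auto)
      finally show ?thesis by (simp add: power2_eq_square mult.assoc)
    qed
  qed
  then have "convergent_prod ?f"
    by (intro abs_convergent_prod_imp_convergent_prod summable_imp_abs_convergent_prod)
  then have "Bseq (\<lambda>n. \<Prod>i\<le>n. ?f i)"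
    by (intro convergent_imp_Bseq convergentI[OF convergent_prod_LIMSEQ])
  then obtain C where C: "C > 0" "\<And>n. \<bar>\<Prod>i\<le>n. ?f i\<bar> \<le> C" unfolding Bseq_def by auto
  have "\<bar>v n\<bar> \<le> C * (real n + 1)" for n
  proof -
    have "(\<Prod>i<n. ?f i) * 1 \<le> (\<Prod>i<n. ?f i) * ?f n"
      by (intro mult_left_mono prod_nonneg) auto
    then have "(\<Prod>i<n. ?f i) \<le> (\<Prod>i<Suc n. ?f i)"
      by (simp only: mult_1_right prod.lessThan_Suc)
    also have "\<dots> \<le> C" using C(2)[of n] by (simp only: lessThan_Suc_atMost)
    finally have le: "(\<Prod>i<n. ?f i) \<le> C" .
    have "\<bar>v n\<bar> \<le> (real n + 1) * (\<Prod>i<n. ?f i)"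
      by (rule perturbed_chebyshev_bound[where e = "\<lambda>n. q ^ Suc n" and t = t])
         (use assms in \<open>auto simp: abs_mult power_abs\<close>)
    also have "\<dots> \<le> (real n + 1) * C" by (intro mult_left_mono le) auto
    finally show ?thesis by (simp add: mult.commute)
  qed
  with C(1) that show thesis by blast
qed

text \<open>The unperturbed case: with zero error the product in the general bound is 1.\<close>

lemma cheb_U_bound: "\<bar>cheb_U n (cos t)\<bar> \<le> real n + 1"
  using perturbed_chebyshev_bound[of "\<lambda>n. cheb_U n (cos t)" t "\<lambda>_. 0" 0 n] by simp

subsection \<open>The theta series\<close>

text \<open>With \<open>k = n + 2 * j\<close>, this is the part of the summand of
  \<open>gamma_coeff\<close> that depends on \<open>j\<close> alone. The exponents are the
  triangular numbers.\<close>

definition theta_coeff :: "real \<Rightarrow> nat \<Rightarrow> real" where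
  "theta_coeff q j = (-1) ^ j * q ^ (j * (j + 1) div 2)"

lemma theta_coeff_0 [simp]: "theta_coeff q 0 = 1"
  by (simp add: theta_coeff_def)

lemma theta_coeff_Suc: "theta_coeff q (Suc j) = - (q ^ Suc j) * theta_coeff q j"
proof -
  have "Suc j * (Suc j + 1) = j * (j + 1) + Suc j * 2" by simp
  then have "Suc j * (Suc j + 1) div 2 = j * (j + 1) div 2 + Suc j" by presburger
  then show ?thesis by (simp add: theta_coeff_def power_add)
qed

lemma theta_coeff_bound: "\<bar>q\<bar> < 1 \<Longrightarrow> \<bar>theta_coeff q j\<bar> \<le> \<bar>q\<bar> ^ j"
proof (induction j)
  case (Suc j)
  have "\<bar>theta_coeff q (Suc j)\<bar> = \<bar>q\<bar> ^ Suc j * \<bar>theta_coeff q j\<bar>"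
    by (simp add: theta_coeff_Suc abs_mult power_abs)
  also have "\<dots> \<le> \<bar>q\<bar> ^ Suc j * 1"
    using Suc by (intro mult_left_mono order.trans[OF Suc.IH power_le_one]) auto
  finally show ?case by simp
qed simp

text \<open>Combines the two q-Pascal rules to raise the upper index by two, as the step from
  \<open>2 * N + 1\<close> to \<open>2 * N + 3\<close> in the finite triple product
  requires.\<close>

lemma q_binomial_Suc_Suc_Suc:
  assumes q: "\<bar>q\<bar> < 1" and m: "m \<le> n"
  shows "q_binomial q (Suc (Suc n)) (Suc m) =
    (1 + q ^ Suc n) * q_binomial q n m + q ^ Suc m * q_binomial q n (Suc m)
    + (case m of 0 \<Rightarrow> 0 | Suc l \<Rightarrow> q ^ (n - l) * q_binomial q n l)"
proof -
  have "q ^ m * q ^ (n - m) = q ^ n" using m by (simp flip: power_add)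
  moreover have "q_binomial q (Suc n) m =
      q_binomial q n m + (case m of 0 \<Rightarrow> 0 | Suc l \<Rightarrow> q ^ (n - l) * q_binomial q n l)"
    using m q by (cases m) (auto simp: q_binomial_Suc_Suc'[OF q])
  ultimately show ?thesis
    unfolding q_binomial_Suc_Suc[OF q, of "Suc n" m] q_binomial_Suc_Suc'[OF q m]
    by (simp add: algebra_simps)
qed

text \<open>With \<open>Q = q ^ Suc N\<close>, the next factor of the finite product is
  \<open>1 + Q^2 - Q * (4 * c^2 - 2)\<close>, and multiplication by \<open>4 * c^2 - 2\<close> moves
  the even-index Chebyshev coefficients one place up and down. The three terms on the right are
  these contributions; the value at \<open>j = 0\<close> reflects
  \<open>U (-2) = - U 0\<close>.\<close>

lemma theta_finite_coeff_step:
  fixes s :: "nat \<Rightarrow> nat \<Rightarrow> real"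
  assumes q: "\<bar>q\<bar> < 1"
  defines "s \<equiv> \<lambda>N j. if j \<le> N then theta_coeff q j * q_binomial q (2 * N + 1) (N - j) else 0"
  shows "s (Suc N) j = (1 + q ^ (2 * N + 2)) * s N j
    - q ^ Suc N * (case j of 0 \<Rightarrow> - s N 0 | Suc i \<Rightarrow> s N i) - q ^ Suc N * s N (Suc j)"
proof -
  consider "j > Suc N" | "j = Suc N" | "j \<le> N" by linarith
  then show ?thesis
  proof cases
    case 1
    then show ?thesis by (auto simp: s_def split: nat.split)
  next
    case 2
    then show ?thesis using q by (simp add: s_def theta_coeff_Suc)
  next
    case 3
    then obtain m where N: "N = j + m" using le_Suc_ex by blast
    have rec: "q_binomial q (2 * Suc N + 1) (Suc N - j) =
        (1 + q ^ (2 * N + 2)) * q_binomial q (2 * N + 1) m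
        + q ^ Suc m * q_binomial q (2 * N + 1) (Suc m)
        + (case m of 0 \<Rightarrow> 0 | Suc l \<Rightarrow> q ^ (2 * N + 1 - l) * q_binomial q (2 * N + 1) l)"
      using q_binomial_Suc_Suc_Suc[OF q, of m "2 * N + 1"] by (simp add: N Suc_diff_le)
    have up: "- (q ^ Suc N * s N (Suc j)) = theta_coeff q j *
        (case m of 0 \<Rightarrow> 0 | Suc l \<Rightarrow> q ^ (2 * N + 1 - l) * q_binomial q (2 * N + 1) l)"
    proof (cases m)
      case (Suc l)
      \<comment> \<open>Here \<open>N = j + l + 1\<close>, so the power of \<open>q\<close> from the
        recurrence and the one from \<open>theta_coeff_Suc\<close> combine to the power in the
        Pascal rule.\<close>
      have "Suc N + Suc j = 2 * N + 1 - l" by (simp add: N Suc)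
      then have "q ^ Suc N * q ^ Suc j = q ^ (2 * N + 1 - l)" by (simp only: flip: power_add)
      then show ?thesis
        by (simp add: s_def N Suc theta_coeff_Suc mult_ac del: power_Suc)
    qed (simp add: s_def N)
    have down: "- (q ^ Suc N * (case j of 0 \<Rightarrow> - s N 0 | Suc i \<Rightarrow> s N i)) =
        theta_coeff q j * (q ^ Suc m * q_binomial q (2 * N + 1) (Suc m))"
    proof (cases j)
      case 0
      \<comment> \<open>The lower neighbour of \<open>j = 0\<close> is missing; by symmetry of row
        \<open>2 * N + 1\<close>, its q-binomial equals the one at \<open>j = 0\<close>, which
        explains the default \<open>- s N 0\<close>.\<close>
      have "q_binomial q (2 * N + 1) (Suc m) = q_binomial q (2 * N + 1) N"
        using q_binomial_symmetric[of N "2 * N + 1" q] by (simp add: N 0)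
      then show ?thesis by (simp add: s_def N 0)
    next
      case (Suc i)
      have "q ^ Suc N = q ^ Suc i * q ^ Suc m" by (simp add: N Suc power_add)
      then show ?thesis by (simp add: s_def N Suc theta_coeff_Suc mult_ac Suc_diff_le del: power_Suc)
    qed
    have "s (Suc N) j = theta_coeff q j * q_binomial q (2 * Suc N + 1) (Suc N - j)"
      by (simp add: s_def N)
    moreover have "s N j = theta_coeff q j * q_binomial q (2 * N + 1) m"
      by (simp add: s_def N)
    ultimately show ?thesis using up down unfolding rec by (simp add: algebra_simps)
  qed
qed

text \<open>For \<open>c = cos t\<close> the factor is \<open>2 * cos (2 * t)\<close>, which shifts
  the index by two in both directions.\<close>

lemma cheb_U_mult_cos_double:
  "(4 * c\<^sup>2 - 2) * cheb_U (Suc (Suc m)) c = cheb_U (Suc (Suc (Suc (Suc m)))) c + cheb_U m c"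
  by (simp add: algebra_simps power2_eq_square)

text \<open>The index shift summed up, with \<open>- s 0\<close> as the boundary contribution of
  \<open>U (-2) = - U 0\<close>.\<close>

lemma cheb_U_even_sum_mult:
  "(4 * c\<^sup>2 - 2) * (\<Sum>j\<le>M. s j * cheb_U (2 * j) c) =
     (\<Sum>j\<le>M. s j * cheb_U (2 * Suc j) c) + (\<Sum>j<M. s (Suc j) * cheb_U (2 * j) c) - s 0"
proof (induction M)
  case 0
  show ?case by (simp add: algebra_simps power2_eq_square numeral_2_eq_2)
next
  case (Suc M)
  have "(4 * c\<^sup>2 - 2) * (s (Suc M) * cheb_U (2 * Suc M) c) =
      s (Suc M) * (cheb_U (2 * Suc (Suc M)) c + cheb_U (2 * M) c)"
    using cheb_U_mult_cos_double[of c "2 * M"] by (simp add: algebra_simps del: cheb_U.simps)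
  then show ?case
    by (simp add: distrib_left Suc.IH del: cheb_U.simps mult_Suc_right)
qed

text \<open>A finite form of the Jacobi triple product.\<close>

lemma finite_theta_product:
  assumes q: "\<bar>q\<bar> < 1"
  shows "(\<Prod>k<N. (1 + q ^ Suc k)\<^sup>2 - 4 * c\<^sup>2 * q ^ Suc k) =
    (\<Sum>j\<le>N. theta_coeff q j * q_binomial q (2 * N + 1) (N - j) * cheb_U (2 * j) c)"
proof -
  define s where "s N j = (if j \<le> N then theta_coeff q j * q_binomial q (2 * N + 1) (N - j) else 0)" for N j
  note step = theta_finite_coeff_step[OF q, folded s_def]
  have "(\<Prod>k<N. (1 + q ^ Suc k)\<^sup>2 - 4 * c\<^sup>2 * q ^ Suc k) = (\<Sum>j\<le>N. s N j * cheb_U (2 * j) c)"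
  proof (induction N)
    case (Suc N)
    let ?U = "\<lambda>j. cheb_U (2 * j) c"
    let ?S = "\<Sum>j\<le>N. s N j * ?U j"
    \<comment> \<open>Coefficients beyond \<open>N\<close> vanish, so all sums may run to
      \<open>Suc N\<close> and the surplus terms drop out.\<close>
    have z: "s N (Suc N) = 0" "s N (Suc (Suc N)) = 0" by (simp_all add: s_def)
    have a: "(\<Sum>j\<le>Suc N. s N j * ?U j) = ?S"
      using z by simp
    have b: "(\<Sum>j\<le>Suc N. (case j of 0 \<Rightarrow> - s N 0 | Suc i \<Rightarrow> s N i) * ?U j) =
        (\<Sum>j\<le>N. s N j * ?U (Suc j)) - s N 0"
      unfolding sum.atMost_Suc_shift by simp
    have c: "(\<Sum>j\<le>Suc N. s N (Suc j) * ?U j) = (\<Sum>j<N. s N (Suc j) * ?U j)"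
      using z by (simp del: cheb_U.simps flip: lessThan_Suc_atMost)
    have "(\<Sum>j\<le>Suc N. s (Suc N) j * ?U j) =
        (1 + q ^ (2 * N + 2)) * (\<Sum>j\<le>Suc N. s N j * ?U j)
        - q ^ Suc N * (\<Sum>j\<le>Suc N. (case j of 0 \<Rightarrow> - s N 0 | Suc i \<Rightarrow> s N i) * ?U j)
        - q ^ Suc N * (\<Sum>j\<le>Suc N. s N (Suc j) * ?U j)"
      unfolding sum_distrib_left sum_subtractf[symmetric] step
      by (intro sum.cong refl) (simp only: left_diff_distrib mult.assoc)
    also have "\<dots> = (1 + q ^ (2 * N + 2)) * ?S - q ^ Suc N * ((4 * c\<^sup>2 - 2) * ?S)"
      unfolding a b c cheb_U_even_sum_mult by algebra
    also have "\<dots> = ?S * ((1 + q ^ Suc N)\<^sup>2 - 4 * c\<^sup>2 * q ^ Suc N)"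
    proof -
      have "q ^ (2 * N + 2) = q ^ Suc N * q ^ Suc N" by (simp add: mult_2 flip: power_add)
      then show ?thesis by (simp add: algebra_simps power2_eq_square del: power_Suc)
    qed
    finally show ?case using Suc.IH by simp
  qed (use q in \<open>simp add: s_def\<close>)
  then show ?thesis by (simp add: s_def)
qed

text \<open>The common majorant of all theta-type series, where \<open>b\<close> is a q-binomial or
  1. The linear growth of \<open>cheb_U\<close> is split into a factor in \<open>n\<close> and a
  factor in \<open>j\<close>, and the latter is enlarged to a square to fit
  \<open>summable_square_times_geometric\<close>.\<close>

lemma theta_term_bound:
  assumes q: "\<bar>q\<bar> < 1" and b: "\<bar>b\<bar> \<le> C"
  shows "\<bar>theta_coeff q j * b * cheb_U (n + 2 * j) (cos t)\<bar>
           \<le> 2 * C * (real n + 1) * ((real j + 1)\<^sup>2 * \<bar>q\<bar> ^ j)"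
proof -
  have C: "C \<ge> 0" using b by linarith
  have "\<bar>theta_coeff q j * b * cheb_U (n + 2 * j) (cos t)\<bar> \<le> \<bar>q\<bar> ^ j * C * (real n + 2 * real j + 1)"
    unfolding abs_mult using theta_coeff_bound[OF q, of j] b cheb_U_bound[of "n + 2 * j" t]
    by (intro mult_mono mult_nonneg_nonneg C) auto
  also have "\<dots> \<le> \<bar>q\<bar> ^ j * C * (2 * (real n + 1) * (real j + 1)\<^sup>2)"
  proof (intro mult_left_mono mult_nonneg_nonneg C)
    have "real n + 2 * real j + 1 \<le> 2 * (real n + 1) * (real j + 1)"
      by (simp add: algebra_simps)
    also have "\<dots> \<le> 2 * (real n + 1) * (real j + 1)\<^sup>2"
      by (intro mult_left_mono) (auto simp: power2_eq_square)
    finally show "real n + 2 * real j + 1 \<le> 2 * (real n + 1) * (real j + 1)\<^sup>2" .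
  qed auto
  finally show ?thesis using C by (simp add: mult_ac)
qed

lemma theta_factor_bound:
  fixes q c :: real
  assumes q: "\<bar>q\<bar> < 1" and c: "\<bar>c\<bar> \<le> 1"
  shows "\<bar>(1 + q ^ k)\<^sup>2 - 4 * c\<^sup>2 * q ^ k - 1\<bar> \<le> 7 * \<bar>q\<bar> ^ k"
proof -
  have "\<bar>q ^ k\<bar> \<le> 1" using q by (simp add: power_abs power_le_one)
  moreover have "c\<^sup>2 \<le> 1" using c by (simp add: abs_square_le_1)
  \<comment> \<open>The constant is \<open>2 + 1 + 4\<close>, one summand for each term of the
    cofactor of \<open>q ^ k\<close>.\<close>
  ultimately have "\<bar>2 + q ^ k - 4 * c\<^sup>2\<bar> \<le> 7"
    using zero_le_power2[of c] unfolding abs_le_iff by linarith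
  then have "\<bar>q ^ k\<bar> * \<bar>2 + q ^ k - 4 * c\<^sup>2\<bar> \<le> \<bar>q ^ k\<bar> * 7" by (intro mult_left_mono) auto
  moreover have "(1 + q ^ k)\<^sup>2 - 4 * c\<^sup>2 * q ^ k - 1 = q ^ k * (2 + q ^ k - 4 * c\<^sup>2)"
    by (simp add: algebra_simps power2_eq_square)
  ultimately show ?thesis by (simp add: abs_mult power_abs mult.commute)
qed

text \<open>Let \<open>N\<close> tend to infinity in \<open>finite_theta_product\<close>. The
  uniform bound on q-binomials supplies the majorant with which Tannery's theorem justifies the
  termwise limit.\<close>

lemma theta_series_eq_product:
  fixes q t :: real
  assumes q: "\<bar>q\<bar> < 1"
  shows "(\<Sum>j. theta_coeff q j * cheb_U (2 * j) (cos t)) =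
    q_poch_inf q q * (\<Prod>k. (1 + q ^ Suc k)\<^sup>2 - 4 * (cos t)\<^sup>2 * q ^ Suc k)"
proof -
  let ?Q = "q_poch_inf q q"
  \<comment> \<open>The finite sum is padded with zeros to a series in \<open>j\<close>, so that the
    limit in \<open>N\<close> can be taken under a fixed summation range.\<close>
  define a where "a j N = (if j \<le> N then theta_coeff q j * q_binomial q (2 * N + 1) (N - j)
    * cheb_U (2 * j) (cos t) else 0)" for j N
  obtain C where C: "C \<ge> 0" "\<And>n k. \<bar>q_binomial q n k\<bar> \<le> C" using q_binomial_bounded[OF q] by blast
  define M where "M j = 2 * C * ((real j + 1)\<^sup>2 * \<bar>q\<bar> ^ j)" for j
  have "(\<lambda>N. suminf (\<lambda>j. a j N)) \<longlonglongrightarrow>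
      suminf (\<lambda>j. theta_coeff q j * inverse ?Q * cheb_U (2 * j) (cos t))"
  proof (rule tannerys_theorem[THEN conjunct2, THEN conjunct2])
    show "(\<lambda>N. a j N) \<longlonglongrightarrow> theta_coeff q j * inverse ?Q * cheb_U (2 * j) (cos t)" for j
    proof (rule Lim_transform_eventually)
      show "(\<lambda>N. theta_coeff q j * q_binomial q (2 * N + 1) (N - j) * cheb_U (2 * j) (cos t))
        \<longlonglongrightarrow> theta_coeff q j * inverse ?Q * cheb_U (2 * j) (cos t)"
        by (intro tendsto_mult tendsto_const q_binomial_central_tendsto[OF q])
      show "\<forall>\<^sub>F N in sequentially. theta_coeff q j * q_binomial q (2 * N + 1) (N - j)
          * cheb_U (2 * j) (cos t) = a j N"
        using eventually_ge_at_top[of j] by eventually_elim (simp add: a_def)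
    qed
    have "norm (a j N) \<le> M j" for j N
      using theta_term_bound[OF q C(2), of j "2 * N + 1" "N - j" 0 t] C(1) by (simp add: a_def M_def)
    then show "\<forall>\<^sub>F (j, N) in at_top \<times>\<^sub>F sequentially. norm (a j N) \<le> M j"
      by (intro always_eventually) auto
    show "summable M"
      unfolding M_def by (intro summable_mult summable_square_times_geometric q)
  qed simp
  moreover have "suminf (\<lambda>j. a j N) = (\<Prod>k<N. (1 + q ^ Suc k)\<^sup>2 - 4 * (cos t)\<^sup>2 * q ^ Suc k)" for N
  proof -
    have "suminf (\<lambda>j. a j N) = (\<Sum>j\<le>N. a j N)" by (rule suminf_finite) (auto simp: a_def)
    then show ?thesis unfolding finite_theta_product[OF q] by (simp add: a_def)
  qed
  moreover have "(\<lambda>N. \<Prod>k<N. (1 + q ^ Suc k)\<^sup>2 - 4 * (cos t)\<^sup>2 * q ^ Suc k) \<longlonglongrightarrow>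
      (\<Prod>k. (1 + q ^ Suc k)\<^sup>2 - 4 * (cos t)\<^sup>2 * q ^ Suc k)"
  proof (rule tendsto_prodinf_geometric[OF _ q])
    show "\<bar>(1 + q ^ Suc k)\<^sup>2 - 4 * (cos t)\<^sup>2 * q ^ Suc k - 1\<bar> \<le> (7 * \<bar>q\<bar>) * \<bar>q\<bar> ^ k" for k
      using theta_factor_bound[OF q, of "cos t" "Suc k"] by (simp add: mult_ac)
  qed
  ultimately have "(\<Prod>k. (1 + q ^ Suc k)\<^sup>2 - 4 * (cos t)\<^sup>2 * q ^ Suc k) =
      suminf (\<lambda>j. theta_coeff q j * inverse ?Q * cheb_U (2 * j) (cos t))"
    using LIMSEQ_unique by auto
  also have "\<dots> = suminf (\<lambda>j. inverse ?Q * (theta_coeff q j * cheb_U (2 * j) (cos t)))"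
    by (simp only: mult_ac)
  also have "\<dots> = inverse ?Q * suminf (\<lambda>j. theta_coeff q j * cheb_U (2 * j) (cos t))"
  proof (rule suminf_mult)
    show "summable (\<lambda>j. theta_coeff q j * cheb_U (2 * j) (cos t))"
    proof (rule summable_comparison_test')
      show "summable (\<lambda>j. 2 * ((real j + 1)\<^sup>2 * \<bar>q\<bar> ^ j))"
        by (intro summable_mult summable_square_times_geometric q)
    qed (use theta_term_bound[OF q, of 1 1 _ 0 t] in simp)
  qed
  finally show ?thesis using q_poch_inf_self_nonzero[OF q] by simp
qed

section \<open>The coefficients \<open>a n\<close>: convergence, growth and recurrence\<close>

definition theta_series :: "real \<Rightarrow> real \<Rightarrow> nat \<Rightarrow> real" where
  "theta_series q c n = (\<Sum>j. theta_coeff q j * q_binomial q (n + j) n * cheb_U (n + 2 * j) c)"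

text \<open>The indices of the q-binomial and of the Chebyshev polynomial are kept independent
  because the recurrence proofs split the series into mixed ones.\<close>

lemma summable_theta_series:
  assumes q: "\<bar>q\<bar> < 1"
  shows "summable (\<lambda>j. \<bar>theta_coeff q j * q_binomial q (m + j) n * cheb_U (k + 2 * j) (cos t)\<bar>)"
proof -
  obtain C where C: "C \<ge> 0" "\<And>n k. \<bar>q_binomial q n k\<bar> \<le> C" using q_binomial_bounded[OF q] by blast
  show ?thesis
  proof (rule summable_comparison_test')
    show "summable (\<lambda>j. 2 * C * (real k + 1) * ((real j + 1)\<^sup>2 * \<bar>q\<bar> ^ j))"
      by (intro summable_mult summable_square_times_geometric q)
  qed (use theta_term_bound[OF q C(2)] in simp)
qed

lemma theta_series_linear_growth:
  assumes q: "\<bar>q\<bar> < 1"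
  obtains C where "C > 0" "\<And>n. \<bar>theta_series q (cos t) n\<bar> \<le> C * (real n + 1)"
proof -
  obtain C where C: "C \<ge> 0" "\<And>n k. \<bar>q_binomial q n k\<bar> \<le> C" using q_binomial_bounded[OF q] by blast
  let ?f = "\<lambda>j. (real j + 1)\<^sup>2 * \<bar>q\<bar> ^ j"
  \<comment> \<open>Adding 1 makes the constant strictly positive even if
    \<open>C = 0\<close>.\<close>
  have "\<bar>theta_series q (cos t) n\<bar> \<le> (2 * C * suminf ?f + 1) * (real n + 1)" for n
  proof -
    have "\<bar>theta_series q (cos t) n\<bar> \<le>
        (\<Sum>j. \<bar>theta_coeff q j * q_binomial q (n + j) n * cheb_U (n + 2 * j) (cos t)\<bar>)"
      unfolding theta_series_def by (rule summable_rabs[OF summable_theta_series[OF q]])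
    also have "\<dots> \<le> (\<Sum>j. 2 * C * (real n + 1) * ?f j)"
      by (intro suminf_le theta_term_bound q C summable_theta_series summable_mult
            summable_square_times_geometric)
    also have "\<dots> = 2 * C * (real n + 1) * suminf ?f"
      by (intro suminf_mult summable_square_times_geometric q)
    finally show ?thesis by (simp add: algebra_simps)
  qed
  moreover have "2 * C * suminf ?f + 1 > 0"
    using C(1) suminf_nonneg[OF summable_square_times_geometric[OF q]]
    by (intro add_nonneg_pos mult_nonneg_nonneg) auto
  ultimately show thesis using that by blast
qed

text \<open>The Chebyshev recurrence splits \<open>2 * cos t * U (n + 1 + 2 * j)\<close> into two
  neighbouring indices. On the left, absorption followed by the q-Pascal rule produces a factor
  \<open>q ^ Suc j\<close>, which turns \<open>theta_coeff q j\<close> into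
  \<open>theta_coeff q (Suc j)\<close> and so moves the terms to the next index of the
  series.\<close>

lemma theta_series_recurrence:
  assumes q: "\<bar>q\<bar> < 1"
  shows "(1 - q ^ Suc (Suc n)) * theta_series q (cos t) (Suc (Suc n)) =
    2 * cos t * theta_series q (cos t) (Suc n) - theta_series q (cos t) n"
proof -
  let ?c = "cos t"
  \<comment> \<open>The index \<open>m\<close> belongs to the q-binomial and \<open>k\<close> to the
    Chebyshev polynomial; the series of interest have \<open>m = k\<close>.\<close>
  define f where "f m k j = theta_coeff q j * q_binomial q (m + j) m * cheb_U (k + 2 * j) ?c" for m k j
  have summ: "summable (f m k)" for m k
    unfolding f_def by (rule summable_rabs_cancel[OF summable_theta_series[OF q]])
  have th: "theta_series q ?c n = suminf (f n n)" for n
    by (simp add: theta_series_def f_def[abs_def])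
  have step: "(1 - q ^ Suc (Suc n)) * f (Suc (Suc n)) (Suc (Suc n)) j =
      f (Suc n) (Suc (Suc n)) j + (f (Suc n) n (Suc j) - f n n (Suc j))" for j
  proof -
    have pascal: "q_binomial q (n + Suc j) n - q_binomial q (Suc (n + Suc j)) (Suc n)
        = - (q ^ Suc n * q_binomial q (Suc n + j) (Suc n))"
      using q_binomial_Suc_Suc[OF q, of "n + Suc j" n] by (simp del: power_Suc)
    have absorb: "(1 - q ^ Suc (Suc n)) * q_binomial q (Suc (Suc n + j)) (Suc (Suc n)) =
        (1 - q ^ Suc (Suc n + j)) * q_binomial q (Suc n + j) (Suc n)"
      by (rule q_binomial_absorb[OF q])
    have "q ^ Suc j * q ^ Suc n = q ^ Suc (Suc n + j)" by (simp add: power_add)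
    then have "(1 - q ^ Suc (Suc n)) * q_binomial q (Suc (Suc n + j)) (Suc (Suc n)) =
        q_binomial q (Suc n + j) (Suc n)
        + q ^ Suc j * (q_binomial q (n + Suc j) n - q_binomial q (Suc (n + Suc j)) (Suc n))"
      unfolding pascal absorb by (simp add: algebra_simps del: power_Suc)
    then have "(1 - q ^ Suc (Suc n)) * q_binomial q (Suc (Suc n + j)) (Suc (Suc n))
        * (theta_coeff q j * cheb_U (Suc (Suc n) + 2 * j) ?c) =
      (q_binomial q (Suc n + j) (Suc n)
        + q ^ Suc j * (q_binomial q (n + Suc j) n - q_binomial q (Suc (n + Suc j)) (Suc n)))
        * (theta_coeff q j * cheb_U (Suc (Suc n) + 2 * j) ?c)" by simp
    then show ?thesis
      unfolding f_def theta_coeff_Suc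
      by (simp add: algebra_simps del: power_Suc cheb_U.simps)
  qed
  have "2 * ?c * f (Suc n) (Suc n) j = f (Suc n) (Suc (Suc n)) j + f (Suc n) n j" for j
    by (simp add: f_def algebra_simps)
  then have "2 * ?c * theta_series q ?c (Suc n) = suminf (f (Suc n) (Suc (Suc n))) + suminf (f (Suc n) n)"
    by (simp add: th suminf_mult[OF summ, symmetric] suminf_add[OF summ summ, symmetric])
  moreover have "suminf (f (Suc n) n) - suminf (f n n) = (\<Sum>j. f (Suc n) n (Suc j) - f n n (Suc j))"
  proof -
    \<comment> \<open>The terms at \<open>j = 0\<close> cancel, so the difference of the two series
      is the shifted sum occurring in \<open>step\<close>.\<close>
    have "f (Suc n) n 0 = f n n 0" using q by (simp add: f_def)
    then have "suminf (f (Suc n) n) - suminf (f n n) = (\<Sum>j. f (Suc n) n (Suc j)) - (\<Sum>j. f n n (Suc j))"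
      using suminf_split_head[OF summ, of "Suc n" n] suminf_split_head[OF summ, of n n] by simp
    then show ?thesis
      by (simp add: suminf_diff[symmetric] summable_Suc_iff summ)
  qed
  moreover have "(1 - q ^ Suc (Suc n)) * theta_series q ?c (Suc (Suc n)) =
      suminf (f (Suc n) (Suc (Suc n))) + (\<Sum>j. f (Suc n) n (Suc j) - f n n (Suc j))"
    unfolding th suminf_mult[OF summ, symmetric] step
    by (intro suminf_add[symmetric] summable_diff) (simp_all add: summable_Suc_iff summ)
  ultimately show ?thesis by (simp add: th)
qed

text \<open>The initial case of the recurrence, in which the term of index -1 is absent.\<close>

lemma theta_series_recurrence_0:
  assumes q: "\<bar>q\<bar> < 1"
  shows "(1 - q) * theta_series q (cos t) (Suc 0) = 2 * cos t * theta_series q (cos t) 0"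
proof -
  let ?c = "cos t"
  define f where "f m k j = theta_coeff q j * q_binomial q (m + j) m * cheb_U (k + 2 * j) ?c" for m k j
  have summ: "summable (f m k)" for m k
    unfolding f_def by (rule summable_rabs_cancel[OF summable_theta_series[OF q]])
  have th: "theta_series q ?c n = suminf (f n n)" for n
    by (simp add: theta_series_def f_def[abs_def])
  \<comment> \<open>This is the Chebyshev term of index \<open>2 * j - 1\<close>, with
    \<open>U (-1) = 0\<close> at \<open>j = 0\<close>.\<close>
  define g where "g j = theta_coeff q j * (case j of 0 \<Rightarrow> 0 | Suc i \<Rightarrow> cheb_U (1 + 2 * i) ?c)" for j
  have fg: "2 * ?c * f 0 0 j = f 0 1 j + g j" for j
    using q by (cases j) (simp_all add: f_def g_def algebra_simps)
  have gdiff: "g = (\<lambda>j. 2 * ?c * f 0 0 j - f 0 1 j)" using fg by auto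
  have g: "summable g"
    unfolding gdiff by (intro summable_diff summable_mult summ)
  have step: "(1 - q) * f 1 1 j = f 0 1 j + g (Suc j)" for j
  proof -
    have "(1 - q) * q_binomial q (Suc j) (Suc 0) = 1 - q ^ Suc j"
      using q_binomial_absorb[OF q, of 0 j] q by simp
    then have "(1 - q) * q_binomial q (Suc j) (Suc 0) * (theta_coeff q j * cheb_U (1 + 2 * j) ?c) =
        (1 - q ^ Suc j) * (theta_coeff q j * cheb_U (1 + 2 * j) ?c)" by simp
    then show ?thesis
      using q by (simp add: f_def g_def theta_coeff_Suc algebra_simps del: power_Suc cheb_U.simps)
  qed
  have "2 * ?c * theta_series q ?c 0 = suminf (f 0 1) + suminf g"
    unfolding th suminf_mult[OF summ, symmetric] fg by (rule suminf_add[OF summ g, symmetric])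
  also have "suminf g = (\<Sum>j. g (Suc j))"
    using suminf_split_head[OF g] by (simp add: g_def)
  also have "suminf (f 0 1) + \<dots> = (1 - q) * theta_series q ?c (Suc 0)"
    unfolding th One_nat_def[symmetric] suminf_mult[OF summ, symmetric] step
    by (rule suminf_add) (use summ g in \<open>simp_all add: summable_Suc_iff\<close>)
  finally show ?thesis ..
qed

subsection \<open>The q-Mehler type generating function\<close>

text \<open>Products of solutions of two second-order recurrences span four quantities, which leads
  to a recurrence of order four. Its right-hand side collects the terms weighted by powers of
  \<open>q ^ n\<close>; in the generating function these turn \<open>r\<close> into
  \<open>r * q\<close>.\<close>

lemma mehler_recurrence:
  fixes a h m :: "nat \<Rightarrow> real"
  assumes h2: "\<And>n. h (Suc (Suc n)) = Y * h (Suc n) - (1 - q ^ Suc n) * h n"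
    and a2: "\<And>n. (1 - q ^ Suc (Suc n)) * a (Suc (Suc n)) = X * a (Suc n) - a n"
  defines "m \<equiv> \<lambda>n. h n * a n"
  shows "m (n + 4) - X * Y * m (n + 3) + (X\<^sup>2 + Y\<^sup>2 - 2) * m (n + 2) - X * Y * m (n + 1) + m n =
    q ^ (n + 4) * m (n + 4) - (1 + q) * (q ^ (n + 2) * m (n + 2)) + q * (q ^ n * m n)"
proof -
  define b where "b = q ^ Suc n"
  have pw: "q ^ n * q = b" "q ^ (n + 2) = q * b" "q ^ (n + 4) = q * (q * (q * b))"
    by (simp_all add: b_def numeral_eq_Suc)
  \<comment> \<open>The recurrence of \<open>a\<close> is run downwards, where it needs no division,
    and that of \<open>h\<close> upwards from \<open>h n\<close> and \<open>h (n + 1)\<close>. What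
    remains is a polynomial identity.\<close>
  define \<alpha> \<beta> where "\<alpha> = a (n + 3)" and "\<beta> = a (n + 2)"
  have a1: "a (n + 1) = X * \<beta> - (1 - q * (q * b)) * \<alpha>"
    using a2[of "n + 1"] by (simp add: b_def \<alpha>_def \<beta>_def numeral_eq_Suc)
  have a0: "a n = X * a (n + 1) - (1 - q * b) * \<beta>"
    using a2[of n] by (simp add: b_def \<beta>_def numeral_eq_Suc)
  have a4: "(1 - q * (q * (q * b))) * a (n + 4) = X * \<alpha> - \<beta>"
    using a2[of "n + 2"] by (simp add: b_def \<alpha>_def \<beta>_def numeral_eq_Suc)
  have hs: "h (n + 2) = Y * h (n + 1) - (1 - b) * h n"
    "h (n + 3) = Y * h (n + 2) - (1 - q * b) * h (n + 1)"
    "h (n + 4) = Y * h (n + 3) - (1 - q * (q * b)) * h (n + 2)"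
    using h2[of n] h2[of "n + 1"] h2[of "n + 2"] by (simp_all add: b_def numeral_eq_Suc)
  have "(1 - q * (q * (q * b))) * m (n + 4) = h (n + 4) * (X * \<alpha> - \<beta>)"
    by (simp add: m_def flip: a4)
  moreover have "h (n + 4) * (X * \<alpha> - \<beta>) - X * Y * m (n + 3) + (X\<^sup>2 + Y\<^sup>2 - 2) * m (n + 2)
      - X * Y * m (n + 1) + m n + (1 + q) * (q * b * m (n + 2)) - b * m n = 0"
    unfolding m_def \<alpha>_def[symmetric] \<beta>_def[symmetric] a0 a1 hs
    by (simp add: algebra_simps power2_eq_square)
  moreover have qm: "q * (q ^ n * m n) = b * m n" by (simp flip: pw(1))
  ultimately show ?thesis unfolding pw qm by (simp add: algebra_simps)
qed

text \<open>Multiply the order-four recurrence by \<open>r ^ (n + 4)\<close> and sum. The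
  coefficients 1, \<open>1 + q\<close> and \<open>q\<close> on its right-hand side give
  \<open>1 - (1 + q) * r^2 + q * r^4\<close>, the product in front of the series at
  \<open>r * q\<close>.\<close>

lemma mehler_functional_equation:
  fixes a h m :: "nat \<Rightarrow> real"
  assumes h: "h 0 = 1" "h (Suc 0) = Y"
    and h2: "\<And>n. h (Suc (Suc n)) = Y * h (Suc n) - (1 - q ^ Suc n) * h n"
    and a1: "(1 - q) * a (Suc 0) = X * a 0"
    and a2: "\<And>n. (1 - q ^ Suc (Suc n)) * a (Suc (Suc n)) = X * a (Suc n) - a n"
  defines "m \<equiv> \<lambda>n. h n * a n"
  assumes S: "summable (\<lambda>n. m n * r ^ n)" and S': "summable (\<lambda>n. m n * (r * q) ^ n)"
  shows "(1 - X * Y * r + (X\<^sup>2 + Y\<^sup>2 - 2) * r\<^sup>2 - X * Y * r ^ 3 + r ^ 4) * (\<Sum>n. m n * r ^ n) =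
    (1 - r\<^sup>2) * (1 - r\<^sup>2 * q) * (\<Sum>n. m n * (r * q) ^ n)"
proof -
  let ?Z = "X\<^sup>2 + Y\<^sup>2 - 2"
  let ?F = "\<Sum>n. m n * r ^ n" and ?G = "\<Sum>n. m n * (r * q) ^ n"
  have F: "(\<lambda>n. r ^ l * (m (n + k) * r ^ (n + k))) sums (r ^ l * (?F - (\<Sum>i<k. m i * r ^ i)))" for k l
    by (intro sums_mult sums_split_initial_segment summable_sums S)
  have G: "(\<lambda>n. r ^ l * (m (n + k) * (r * q) ^ (n + k))) sums (r ^ l * (?G - (\<Sum>i<k. m i * (r * q) ^ i)))" for k l
    by (intro sums_mult sums_split_initial_segment summable_sums S')
  have pw: "r ^ l * (u * r ^ (n + k)) = r ^ (n + 4) * u"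
    "r ^ l * (u * (r * q) ^ (n + k)) = r ^ (n + 4) * (q ^ (n + k) * u)" if "l + k = 4" for l n k u
  proof -
    have "l + (n + k) = n + 4" using that by simp
    then have *: "r ^ l * r ^ (n + k) = r ^ (n + 4)" by (simp only: flip: power_add)
    show "r ^ l * (u * r ^ (n + k)) = r ^ (n + 4) * u" by (simp flip: *)
    show "r ^ l * (u * (r * q) ^ (n + k)) = r ^ (n + 4) * (q ^ (n + k) * u)"
      by (simp add: power_mult_distrib flip: *)
  qed
  define L where "L n = m (n + 4) - X * Y * m (n + 3) + ?Z * m (n + 2) - X * Y * m (n + 1) + m n" for n
  define R where "R n = q ^ (n + 4) * m (n + 4) - (1 + q) * (q ^ (n + 2) * m (n + 2)) + q * (q ^ n * m n)" for n
  have "L = R" unfolding L_def R_def m_def by (rule ext, rule mehler_recurrence[OF h2 a2])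
  have 1: "(\<lambda>n. r ^ (n + 4) * L n) sums (r ^ 0 * (?F - (\<Sum>i<4. m i * r ^ i))
     - X * Y * (r ^ 1 * (?F - (\<Sum>i<3. m i * r ^ i))) + ?Z * (r ^ 2 * (?F - (\<Sum>i<2. m i * r ^ i)))
     - X * Y * (r ^ 3 * (?F - (\<Sum>i<1. m i * r ^ i))) + r ^ 4 * (?F - (\<Sum>i<0. m i * r ^ i)))"
    (is "_ sums ?A")
  proof -
    have "(\<lambda>n. r ^ 0 * (m (n + 4) * r ^ (n + 4)) - X * Y * (r ^ 1 * (m (n + 3) * r ^ (n + 3)))
      + ?Z * (r ^ 2 * (m (n + 2) * r ^ (n + 2))) - X * Y * (r ^ 3 * (m (n + 1) * r ^ (n + 1)))
      + r ^ 4 * (m (n + 0) * r ^ (n + 0))) sums ?A"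
      by (intro sums_add sums_diff F sums_mult[OF F])
    moreover have "r ^ 0 * (m (n + 4) * r ^ (n + 4)) - X * Y * (r ^ 1 * (m (n + 3) * r ^ (n + 3)))
      + ?Z * (r ^ 2 * (m (n + 2) * r ^ (n + 2))) - X * Y * (r ^ 3 * (m (n + 1) * r ^ (n + 1)))
      + r ^ 4 * (m (n + 0) * r ^ (n + 0)) = r ^ (n + 4) * L n" for n
      by (subst (1 2 3 4 5) pw(1)) (simp_all add: L_def algebra_simps)
    ultimately show ?thesis by simp
  qed
  have 2: "(\<lambda>n. r ^ (n + 4) * R n) sums (r ^ 0 * (?G - (\<Sum>i<4. m i * (r * q) ^ i))
     - (1 + q) * (r ^ 2 * (?G - (\<Sum>i<2. m i * (r * q) ^ i)))
     + q * (r ^ 4 * (?G - (\<Sum>i<0. m i * (r * q) ^ i))))"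
    (is "_ sums ?B")
  proof -
    have "(\<lambda>n. r ^ 0 * (m (n + 4) * (r * q) ^ (n + 4)) - (1 + q) * (r ^ 2 * (m (n + 2) * (r * q) ^ (n + 2)))
      + q * (r ^ 4 * (m (n + 0) * (r * q) ^ (n + 0)))) sums ?B"
      by (intro sums_add sums_diff G sums_mult[OF G])
    moreover have "r ^ 0 * (m (n + 4) * (r * q) ^ (n + 4)) - (1 + q) * (r ^ 2 * (m (n + 2) * (r * q) ^ (n + 2)))
      + q * (r ^ 4 * (m (n + 0) * (r * q) ^ (n + 0))) = r ^ (n + 4) * R n" for n
      by (subst (1 2 3) pw(2)) (simp_all add: R_def algebra_simps)
    ultimately show ?thesis by simp
  qed
  have AB: "?A = ?B" using 1 2 \<open>L = R\<close> sums_unique2 by blast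
  have h3: "h 2 = Y * Y - (1 - q)" "h 3 = Y * h 2 - (1 - q\<^sup>2) * Y"
    using h2[of 0] h2[of 1] h by (simp_all add: numeral_eq_Suc)
  have a3: "(1 - q\<^sup>2) * a 2 = X * a 1 - a 0" "(1 - q ^ 3) * a 3 = X * a 2 - a 1"
    using a2[of 0] a2[of 1] by (simp_all add: numeral_eq_Suc)
  \<comment> \<open>The summed recurrence covers the powers of \<open>r\<close> from 4 on.
    \<open>c1\<close>, \<open>c2\<close> and \<open>c3\<close> are its continuations to the powers
    1, 2 and 3, with \<open>m\<close> set to 0 at negative indices.\<close>
  have c1: "(1 - q) * m 1 = X * Y * m 0" using a1 h by (simp add: m_def)
  have c2: "(1 - q\<^sup>2) * m 2 - X * Y * m 1 + (?Z + 1 + q) * m 0 = 0"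
  proof -
    have "(1 - q\<^sup>2) * m 2 = (Y * Y - (1 - q)) * (X * a 1 - a 0)"
      unfolding m_def a3(1)[symmetric] h3(1) by simp
    moreover have "m 1 = Y * a 1" "m 0 = a 0" using h by (simp_all add: m_def)
    moreover have "(Y * Y - (1 - q)) * (X * a 1 - a 0) - X * Y * (Y * a 1) + (?Z + 1 + q) * a 0
        = X * (X * a 0 - (1 - q) * a 1)"
      by (simp add: algebra_simps power2_eq_square)
    moreover have "X * a 0 - (1 - q) * a 1 = 0" using a1 by simp
    ultimately show ?thesis by (simp only: mult_zero_right)
  qed
  have c3: "(1 - q ^ 3) * m 3 - X * Y * m 2 + (?Z + (1 + q) * q) * m 1 - X * Y * m 0 = 0"
  proof -
    have a0: "a 0 = X * a 1 - (1 - q\<^sup>2) * a 2" using a3(1) by simp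
    have h1: "h 1 = Y" using h by simp
    have "(1 - q ^ 3) * m 3 = h 3 * (X * a 2 - a 1)"
      unfolding m_def a3(2)[symmetric] by simp
    then show ?thesis unfolding m_def a0 h3 h(1) h1
      by (simp add: algebra_simps power2_eq_square)
  qed
  have low: "(\<Sum>i<4. m i * r ^ i) - X * Y * (r * (\<Sum>i<3. m i * r ^ i)) + ?Z * (r\<^sup>2 * (\<Sum>i<2. m i * r ^ i))
      - X * Y * (r ^ 3 * m 0) =
    (\<Sum>i<4. m i * (r * q) ^ i) - (1 + q) * (r\<^sup>2 * (\<Sum>i<2. m i * (r * q) ^ i))"
    (is "?lA = ?lB")
  proof -
    have "?lA - ?lB = r * ((1 - q) * m 1 - X * Y * m 0)
        + r\<^sup>2 * ((1 - q\<^sup>2) * m 2 - X * Y * m 1 + (?Z + 1 + q) * m 0)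
        + r ^ 3 * ((1 - q ^ 3) * m 3 - X * Y * m 2 + (?Z + (1 + q) * q) * m 1 - X * Y * m 0)"
      by (simp add: eval_nat_numeral algebra_simps)
    then show ?thesis unfolding c1 c2 c3 by simp
  qed
  have "?A = (1 - X * Y * r + ?Z * r\<^sup>2 - X * Y * r ^ 3 + r ^ 4) * ?F - ?lA"
    by (simp add: algebra_simps)
  moreover have "?B = (1 - r\<^sup>2) * (1 - r\<^sup>2 * q) * ?G - ?lB"
    by (simp add: algebra_simps flip: power_add)
  ultimately show ?thesis using AB low by simp
qed

lemma summable_quadratic_growth:
  fixes m :: "nat \<Rightarrow> real"
  assumes m: "\<And>n. \<bar>m n\<bar> \<le> C * (real n + 1)\<^sup>2" and r: "\<bar>r\<bar> < 1"
  shows "summable (\<lambda>n. m n * r ^ n)"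
proof (rule summable_comparison_test')
  show "summable (\<lambda>n. C * ((real n + 1)\<^sup>2 * \<bar>r\<bar> ^ n))"
    by (intro summable_mult summable_square_times_geometric r)
  show "norm (m n * r ^ n) \<le> C * ((real n + 1)\<^sup>2 * \<bar>r\<bar> ^ n)" for n
    using mult_right_mono[OF m, of "\<bar>r\<bar> ^ n" n] by (simp add: abs_mult power_abs mult.assoc)
qed

text \<open>Iterating the functional equation towards \<open>r = 0\<close> turns the generating function
  into an infinite product.\<close>

lemma mehler_product:
  fixes a h m :: "nat \<Rightarrow> real"
  assumes h: "h 0 = 1" "h (Suc 0) = Y"
    and h2: "\<And>n. h (Suc (Suc n)) = Y * h (Suc n) - (1 - q ^ Suc n) * h n"
    and a1: "(1 - q) * a (Suc 0) = X * a 0"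
    and a2: "\<And>n. (1 - q ^ Suc (Suc n)) * a (Suc (Suc n)) = X * a (Suc n) - a n"
  defines "m \<equiv> \<lambda>n. h n * a n"
  assumes growth: "\<And>n. \<bar>m n\<bar> \<le> C * (real n + 1)\<^sup>2"
    and q: "\<bar>q\<bar> < 1" and r: "\<bar>r\<bar> < 1"
  defines "P \<equiv> \<lambda>r. 1 - X * Y * r + (X\<^sup>2 + Y\<^sup>2 - 2) * r\<^sup>2 - X * Y * r ^ 3 + r ^ 4"
  shows "convergent_prod (\<lambda>k. P (r * q ^ k))"
    and "(\<Prod>k. P (r * q ^ k)) * (\<Sum>n. m n * r ^ n) = q_poch_inf q (r\<^sup>2) * a 0"
proof -
  let ?S = "\<lambda>r. \<Sum>n. m n * r ^ n"
  have small: "\<bar>r * q ^ k\<bar> < 1" for k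
  proof -
    have "\<bar>r * q ^ k\<bar> \<le> \<bar>r\<bar> * 1"
      unfolding abs_mult power_abs using q by (intro mult_left_mono power_le_one) auto
    with r show ?thesis by simp
  qed
  have summ: "summable (\<lambda>n. m n * x ^ n)" if "\<bar>x\<bar> < 1" for x
    using growth that by (rule summable_quadratic_growth)
  \<comment> \<open>Each use of the functional equation contributes two consecutive factors of the
    q-Pochhammer product, those of index \<open>2 * N\<close> and \<open>2 * N + 1\<close>.\<close>
  have iter: "(\<Prod>k<N. P (r * q ^ k)) * ?S r = (\<Prod>i<2 * N. 1 - r\<^sup>2 * q ^ i) * ?S (r * q ^ N)" for N
  proof (induction N)
    case (Suc N)
    have *: "P (r * q ^ N) * ?S (r * q ^ N) =
        (1 - r\<^sup>2 * q ^ (2 * N)) * (1 - r\<^sup>2 * q ^ Suc (2 * N)) * ?S (r * q ^ Suc N)"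
      using mehler_functional_equation[OF h h2 a1 a2, of "r * q ^ N"]
        summ[OF small[of N]] summ[OF small[of "Suc N"]]
      by (simp add: m_def P_def mult_ac power_mult_distrib flip: power_mult)
    have "(\<Prod>k<Suc N. P (r * q ^ k)) * ?S r = P (r * q ^ N) * ((\<Prod>k<N. P (r * q ^ k)) * ?S r)"
      by simp
    also have "\<dots> = (\<Prod>i<2 * N. 1 - r\<^sup>2 * q ^ i) * (P (r * q ^ N) * ?S (r * q ^ N))"
      unfolding Suc.IH by simp
    also have "\<dots> = (\<Prod>i<2 * Suc N. 1 - r\<^sup>2 * q ^ i) * ?S (r * q ^ Suc N)"
      unfolding * by simp
    finally show ?case .
  qed simp
  \<comment> \<open>The sum of the absolute values of the coefficients of \<open>P - 1\<close>,
    which bounds its cofactor after one power of the argument is taken out.\<close>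
  define B where "B = \<bar>X * Y\<bar> + \<bar>X\<^sup>2 + Y\<^sup>2 - 2\<bar> + \<bar>X * Y\<bar> + 1"
  have Pbound: "\<bar>P (r * q ^ k) - 1\<bar> \<le> B * \<bar>q\<bar> ^ k" for k
  proof -
    let ?x = "r * q ^ k"
    have x1: "\<bar>?x\<bar> \<le> 1" using small[of k] by simp
    have "\<bar>P ?x - 1\<bar> = \<bar>?x\<bar> * \<bar>- X * Y + (X\<^sup>2 + Y\<^sup>2 - 2) * ?x - X * Y * ?x\<^sup>2 + ?x ^ 3\<bar>"
      unfolding P_def abs_mult[symmetric] by (simp add: algebra_simps eval_nat_numeral)
    also have "\<dots> \<le> \<bar>?x\<bar> * B"
    proof (rule mult_left_mono)
      have "\<bar>?x\<bar> ^ i \<le> 1" for i using x1 by (intro power_le_one) auto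
      then have 1: "\<bar>c * ?x ^ i\<bar> \<le> \<bar>c\<bar>" for c i
        unfolding abs_mult[of c] power_abs by (intro mult_left_le) auto
      show "\<bar>- X * Y + (X\<^sup>2 + Y\<^sup>2 - 2) * ?x - X * Y * ?x\<^sup>2 + ?x ^ 3\<bar> \<le> B"
        unfolding B_def using 1[of "X\<^sup>2 + Y\<^sup>2 - 2" 1] 1[of "X * Y" 2] 1[of 1 3]
        by (simp del: power_mult_distrib)
    qed simp
    also have "\<dots> = \<bar>r\<bar> * (B * \<bar>q\<bar> ^ k)" by (simp add: abs_mult power_abs)
    also have "\<dots> \<le> B * \<bar>q\<bar> ^ k"
      using r by (intro mult_left_le_one_le mult_nonneg_nonneg) (auto simp: B_def)
    finally show ?thesis .
  qed
  have lim: "(\<lambda>N. \<Prod>k<N. P (r * q ^ k)) \<longlonglongrightarrow> (\<Prod>k. P (r * q ^ k))"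
    using Pbound q by (rule tendsto_prodinf_geometric)
  show "convergent_prod (\<lambda>k. P (r * q ^ k))"
    using Pbound q by (rule convergent_prod_geometric)
  \<comment> \<open>Continuity at 0 identifies the limit of the iteration; \<open>1/2\<close> is
    just a point inside the disc of convergence.\<close>
  have "isCont ?S 0"
    by (rule isCont_powser[of _ "1/2"]) (use summ in simp_all)
  moreover have "(\<lambda>N. r * q ^ N) \<longlonglongrightarrow> 0"
    using tendsto_mult_left[OF LIMSEQ_power_zero, of q r] q by simp
  ultimately have "(\<lambda>N. ?S (r * q ^ N)) \<longlonglongrightarrow> ?S 0"
    by (rule isCont_tendsto_compose)
  moreover have "?S 0 = a 0" using powser_zero[of m] h by (simp add: m_def)
  moreover have "(\<lambda>N. \<Prod>i<2 * N. 1 - r\<^sup>2 * q ^ i) \<longlonglongrightarrow> q_poch_inf q (r\<^sup>2)"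
    by (rule filterlim_compose[OF q_poch_inf_tendsto[OF q]])
       (rule filterlim_at_top_mono[OF filterlim_ident], auto intro: eventuallyI)
  ultimately have "(\<lambda>N. (\<Prod>k<N. P (r * q ^ k)) * ?S r) \<longlonglongrightarrow> q_poch_inf q (r\<^sup>2) * a 0"
    unfolding iter by (intro tendsto_mult) auto
  moreover have "(\<lambda>N. (\<Prod>k<N. P (r * q ^ k)) * ?S r) \<longlonglongrightarrow> (\<Prod>k. P (r * q ^ k)) * ?S r"
    by (intro tendsto_mult lim tendsto_const)
  ultimately show "(\<Prod>k. P (r * q ^ k)) * ?S r = q_poch_inf q (r\<^sup>2) * a 0"
    by (rule LIMSEQ_unique[symmetric])
qed

text \<open>The quartic is the product of the squared moduli of \<open>1 - r * cis (t + s)\<close>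
  and \<open>1 - r * cis (t - s)\<close>, which makes its positivity visible.\<close>

lemma mehler_denominator_factor:
  fixes r s t :: real
  shows "1 - (2 * cos t) * (2 * cos s) * r + ((2 * cos t)\<^sup>2 + (2 * cos s)\<^sup>2 - 2) * r\<^sup>2
      - (2 * cos t) * (2 * cos s) * r ^ 3 + r ^ 4
    = (1 - 2 * r * cos (t + s) + r\<^sup>2) * (1 - 2 * r * cos (t - s) + r\<^sup>2)"
proof -
  have "(1 - 2 * r * cos (t + s) + r\<^sup>2) * (1 - 2 * r * cos (t - s) + r\<^sup>2)
      = (1 + r\<^sup>2 - 2 * r * (cos t * cos s))\<^sup>2 - 4 * r\<^sup>2 * ((sin t)\<^sup>2 * (sin s)\<^sup>2)"
    unfolding cos_add cos_diff by (simp add: algebra_simps power2_eq_square)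
  then show ?thesis
    unfolding sin_squared_eq by (simp add: algebra_simps eval_nat_numeral)
qed

text \<open>Each of the two quadratic factors is at least \<open>(1 - \<bar>r\<bar>)^2\<close>. This
  permits division by the denominator product.\<close>

lemma mehler_denominator_pos:
  fixes r s t :: real
  assumes "\<bar>r\<bar> < 1"
  shows "1 - (2 * cos t) * (2 * cos s) * r + ((2 * cos t)\<^sup>2 + (2 * cos s)\<^sup>2 - 2) * r\<^sup>2
      - (2 * cos t) * (2 * cos s) * r ^ 3 + r ^ 4 > 0"
proof -
  have "1 - 2 * r * cos u + r\<^sup>2 > 0" for u
  proof -
    have "\<bar>r * cos u\<bar> \<le> \<bar>r\<bar> * 1" unfolding abs_mult by (intro mult_left_mono) auto
    moreover have "(1 - \<bar>r\<bar>)\<^sup>2 > 0" using assms by simp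
    ultimately show ?thesis by (simp add: power2_eq_square algebra_simps abs_le_iff)
  qed
  then show ?thesis unfolding mehler_denominator_factor by (intro mult_pos_pos)
qed

subsection \<open>The Chebyshev expansion\<close>

text \<open>Scaling by \<open>w = sqrt (1 - q)\<close> turns q-integers into
  \<open>1 - q ^ n\<close>, so the q-Hermite recurrence becomes a small perturbation of the
  Chebyshev one.\<close>

lemma scaled_q_hermite_recurrence:
  fixes w y :: real
  assumes w: "w\<^sup>2 = 1 - q"
  shows "w ^ Suc (Suc n) * q_hermite q (Suc (Suc n)) y =
    (w * y) * (w ^ Suc n * q_hermite q (Suc n) y) - (1 - q ^ Suc n) * (w ^ n * q_hermite q n y)"
proof -
  have *: "w ^ Suc (Suc n) = (1 - q) * w ^ n"
    by (simp flip: w) (simp add: power2_eq_square)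
  have "w ^ Suc (Suc n) * (q_int q (Suc n) * q_hermite q n y) =
      (1 - q) * q_int q (Suc n) * (w ^ n * q_hermite q n y)"
    unfolding * by (simp only: mult_ac)
  then show ?thesis
    unfolding q_hermite.simps q_int_eq[symmetric] right_diff_distrib by simp
qed

text \<open>Writes the summand in terms of \<open>n = k - 2 * j\<close> and \<open>j\<close>, where
  the real power of \<open>1 - q\<close> is the natural power \<open>n\<close> of its square
  root.\<close>

lemma gamma_coeff_eq:
  assumes "q < 1"
  shows "gamma_coeff k y \<rho> q = (\<Sum>j\<le>k div 2. \<rho> ^ (k - 2 * j)
    * (sqrt (1 - q) ^ (k - 2 * j) * q_hermite q (k - 2 * j) y)
    * (theta_coeff q j * q_binomial q (k - 2 * j + j) (k - 2 * j)))"
  unfolding gamma_coeff_def atLeast0AtMost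
proof (rule sum.cong[OF refl])
  fix j assume "j \<in> {..k div 2}"
  then have j: "2 * j \<le> k" by auto
  have "(1 - q) powr (real k / 2 - real j) = ((1 - q) powr (1 / 2)) powr real (k - 2 * j)"
    using j by (simp add: powr_powr of_nat_diff field_simps)
  also have "\<dots> = sqrt (1 - q) ^ (k - 2 * j)"
    using assms by (simp add: powr_half_sqrt powr_realpow)
  finally show "(-1) ^ j * (1 - q) powr (real k / 2 - real j) * q ^ (j * (j + 1) div 2)
        * q_binomial q (k - j) (k - 2 * j) * \<rho> ^ (k - 2 * j) * q_hermite q (k - 2 * j) y =
      \<rho> ^ (k - 2 * j) * (sqrt (1 - q) ^ (k - 2 * j) * q_hermite q (k - 2 * j) y)
        * (theta_coeff q j * q_binomial q (k - 2 * j + j) (k - 2 * j))"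
    using j by (simp add: theta_coeff_def mult_ac)
qed

text \<open>Both sides are iterated sums of one absolutely summable double series: by rows
  \<open>n\<close> on the right, by \<open>k = n + 2 * j\<close> on the left.\<close>

lemma gamma_chebyshev_sums:
  fixes q \<rho> y t :: real
  defines "h \<equiv> \<lambda>n. sqrt (1 - q) ^ n * q_hermite q n y"
  assumes q: "\<bar>q\<bar> < 1" and \<rho>: "\<bar>\<rho>\<bar> < 1"
    and h: "\<And>n. \<bar>h n\<bar> \<le> C * (real n + 1)"
  shows "(\<lambda>k. gamma_coeff k y \<rho> q * cheb_U k (cos t)) sums
    (\<Sum>n. h n * theta_series q (cos t) n * \<rho> ^ n)"
proof -
  define f where "f = (\<lambda>(n, j). \<rho> ^ n * h n
    * (theta_coeff q j * q_binomial q (n + j) n * cheb_U (n + 2 * j) (cos t)))"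
  obtain D where D: "D \<ge> 0" "\<And>n k. \<bar>q_binomial q n k\<bar> \<le> D" using q_binomial_bounded[OF q] by blast
  have C: "C \<ge> 0" using h[of 0] by simp
  \<comment> \<open>The majorant of \<open>f (n, j)\<close> factors as \<open>G n * H j\<close>; the
    square in \<open>G\<close> combines the linear growth of \<open>h\<close> with the linear factor
    from \<open>theta_term_bound\<close>.\<close>
  define G where "G n = 2 * C * D * ((real n + 1)\<^sup>2 * \<bar>\<rho>\<bar> ^ n)" for n
  define H where "H j = (real j + 1)\<^sup>2 * \<bar>q\<bar> ^ j" for j
  have GH0: "G n \<ge> 0" "H n \<ge> 0" for n using C D by (simp_all add: G_def H_def)
  have "(H has_sum suminf H) UNIV"
    unfolding H_def by (intro norm_summable_imp_has_sum summable_sums)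
      (use summable_square_times_geometric[OF q] in simp_all)
  moreover have "G summable_on UNIV"
    unfolding G_def by (intro norm_summable_imp_summable_on)
      (use C D summable_square_times_geometric[OF \<rho>] in \<open>simp add: summable_mult\<close>)
  ultimately have "(\<lambda>(n, j). G n * H j) summable_on (SIGMA n:UNIV. UNIV)"
    by (intro summable_on_SigmaI[where g = "\<lambda>n. G n * suminf H"])
       (auto intro: has_sum_cmult_right summable_on_cmult_left GH0 mult_nonneg_nonneg)
  then have "(\<lambda>p. norm (f p)) summable_on (SIGMA n:UNIV. UNIV)"
  proof (rule abs_summable_on_comparison_test')
    fix p :: "nat \<times> nat"
    obtain n j where p: "p = (n, j)" by fastforce
    have "norm (f p) \<le> \<bar>\<rho>\<bar> ^ n * (C * (real n + 1)) * (2 * D * (real n + 1) * H j)"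
      unfolding f_def p H_def prod.case real_norm_def abs_mult[of "\<rho> ^ n * h n"] abs_mult[of "\<rho> ^ n"] power_abs
      by (intro mult_mono theta_term_bound q D h mult_nonneg_nonneg) (use C in auto)
    also have "\<dots> = G n * H j" by (simp add: G_def power2_eq_square)
    finally show "norm (f p) \<le> (case p of (n, j) \<Rightarrow> G n * H j)" by (simp add: p)
  qed
  then have "f summable_on (SIGMA n:UNIV. UNIV)" by (rule abs_summable_summable)
  then obtain S where S: "(f has_sum S) (SIGMA n:UNIV. UNIV)" by (auto simp: summable_on_def)
  have inner: "((\<lambda>j. f (n, j)) has_sum (h n * theta_series q (cos t) n * \<rho> ^ n)) UNIV" for n
  proof -
    have "((\<lambda>j. theta_coeff q j * q_binomial q (n + j) n * cheb_U (n + 2 * j) (cos t))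
        has_sum theta_series q (cos t) n) UNIV"
      unfolding theta_series_def
      by (intro norm_summable_imp_has_sum summable_sums summable_rabs_cancel[OF summable_theta_series[OF q]])
         (use summable_theta_series[OF q] in simp)
    from has_sum_cmult_right[OF this, of "\<rho> ^ n * h n"] show ?thesis by (simp add: f_def mult_ac)
  qed
  have "((\<lambda>n. h n * theta_series q (cos t) n * \<rho> ^ n) has_sum S) UNIV"
    by (rule has_sum_SigmaD[OF S inner])
  then have SS: "S = (\<Sum>n. h n * theta_series q (cos t) n * \<rho> ^ n)"
    using has_sum_imp_sums sums_unique by blast
  \<comment> \<open>All pairs \<open>(n, j)\<close> correspond to the pairs \<open>(k, j)\<close>
    with \<open>j\<close> at most \<open>k div 2\<close>, so the inner sums become finite.\<close>
  have "((\<lambda>(k, j). f (k - 2 * j, j)) has_sum S) (SIGMA k:UNIV. {..k div 2})"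
    by (rule has_sum_reindex_bij_witness[where i = "\<lambda>(n, j). (n + 2 * j, j)"
          and j = "\<lambda>(k, j). (k - 2 * j, j)", THEN iffD2, OF _ _ _ _ _ refl S]) auto
  then have "((\<lambda>k. \<Sum>j\<le>k div 2. f (k - 2 * j, j)) has_sum S) UNIV"
    by (rule has_sum_SigmaD) (simp add: has_sum_finite)
  moreover have "(\<Sum>j\<le>k div 2. f (k - 2 * j, j)) = gamma_coeff k y \<rho> q * cheb_U k (cos t)" for k
  proof -
    have "q < 1" using q by simp
    have "k - 2 * j + 2 * j = k" if "j \<le> k div 2" for j using that by simp
    then show ?thesis
      unfolding gamma_coeff_eq[OF \<open>q < 1\<close>] sum_distrib_right f_def h_def prod.case
      by (intro sum.cong refl) (simp only: atMost_iff mult.assoc)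
  qed
  ultimately have "((\<lambda>k. gamma_coeff k y \<rho> q * cheb_U k (cos t)) has_sum S) UNIV" by simp
  then show ?thesis unfolding SS by (rule has_sum_imp_sums)
qed

theorem mainTheorem7:
  fixes q \<rho> x y :: real
  assumes "q \<in> {-1<..<1}"
    and "0 < \<bar>\<rho>\<bar>" and "\<bar>\<rho>\<bar> < 1"
    and "x \<in> {- (2 / sqrt (1 - q)) .. 2 / sqrt (1 - q)}"
    and "y \<in> {- (2 / sqrt (1 - q)) .. 2 / sqrt (1 - q)}"
  shows "summable (\<lambda>k. gamma_coeff (Suc k) y \<rho> q * cheb_U (Suc k) (x * sqrt (1 - q) / 2)) \<and>
    f_CN x y \<rho> q =
      f_U x q *
        (1 + (\<Sum>k. gamma_coeff (Suc k) y \<rho> q * cheb_U (Suc k) (x * sqrt (1 - q) / 2)))"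
proof -
  have q: "\<bar>q\<bar> < 1" and \<rho>: "\<bar>\<rho>\<bar> < 1" using assms by auto
  let ?w = "sqrt (1 - q)"
  have w: "?w > 0" "?w\<^sup>2 = 1 - q" using q by simp_all
  have angle: "\<exists>t. ?w * z = 2 * cos t" if "z \<in> {- (2 / ?w) .. 2 / ?w}" for z
  proof -
    have "- 1 \<le> ?w * z / 2" "?w * z / 2 \<le> 1" using that w(1) by (auto simp: field_simps)
    then have "?w * z = 2 * cos (arccos (?w * z / 2))" by simp
    then show ?thesis ..
  qed
  obtain t where t: "?w * x = 2 * cos t" using angle[OF assms(4)] ..
  obtain s where s: "?w * y = 2 * cos s" using angle[OF assms(5)] ..
  have ct: "x * ?w / 2 = cos t" using t by (simp add: mult.commute)
  define h where "h n = ?w ^ n * q_hermite q n y" for n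
  define a where "a = theta_series q (cos t)"
  have h01: "h 0 = 1" "h (Suc 0) = 2 * cos s" using s by (simp_all add: h_def)
  have h2: "h (Suc (Suc n)) = 2 * cos s * h (Suc n) - (1 - q ^ Suc n) * h n" for n
    unfolding h_def scaled_q_hermite_recurrence[OF w(2)] s ..
  obtain C where C: "C > 0" "\<And>n. \<bar>h n\<bar> \<le> C * (real n + 1)"
    by (rule perturbed_chebyshev_linear_growth[OF h01 h2 q]) (rule that)
  obtain D where D: "D > 0" "\<And>n. \<bar>a n\<bar> \<le> D * (real n + 1)"
    by (rule theta_series_linear_growth[OF q, of t, folded a_def]) (rule that)
  define S where "S = (\<Sum>n. h n * a n * \<rho> ^ n)"
  have sums: "(\<lambda>k. gamma_coeff k y \<rho> q * cheb_U k (cos t)) sums S"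
    unfolding S_def a_def h_def by (rule gamma_chebyshev_sums[OF q \<rho> C(2)[unfolded h_def]])
  have summ: "summable (\<lambda>k. gamma_coeff (Suc k) y \<rho> q * cheb_U (Suc k) (cos t))"
    by (rule summable_Suc_iff[THEN iffD2, OF sums_summable[OF sums]])
  \<comment> \<open>The term of index 0 supplies the isolated 1 of the expansion.\<close>
  have "gamma_coeff 0 y \<rho> q = 1" using q by (simp add: gamma_coeff_def)
  then have S_eq: "1 + (\<Sum>k. gamma_coeff (Suc k) y \<rho> q * cheb_U (Suc k) (cos t)) = S"
    using suminf_split_head[OF sums_summable[OF sums]] sums_unique[OF sums] by simp
  have "f_CN x y \<rho> q = f_U x q * S"
  proof (cases "4 - (1 - q) * x\<^sup>2 = 0")
    \<comment> \<open>At an endpoint the prefactor of \<open>f_CN\<close> is a division by 0 and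
      \<open>f_U\<close> contains the square root of 0, so both sides vanish.\<close>
    case True
    then show ?thesis unfolding f_CN_def f_U_def by simp
  next
    case False
    let ?X = "2 * cos t" and ?Y = "2 * cos s"
    define P where "P r = 1 - ?X * ?Y * r + (?X\<^sup>2 + ?Y\<^sup>2 - 2) * r\<^sup>2 - ?X * ?Y * r ^ 3 + r ^ 4" for r
    define N where "N k = (1 + q ^ k)\<^sup>2 - 4 * (cos t)\<^sup>2 * q ^ k" for k
    have growth: "\<bar>h n * a n\<bar> \<le> (C * D) * (real n + 1)\<^sup>2" for n
    proof -
      have "\<bar>h n\<bar> * \<bar>a n\<bar> \<le> (C * (real n + 1)) * (D * (real n + 1))"
        using C D by (intro mult_mono) auto
      then show ?thesis by (simp add: abs_mult power2_eq_square mult_ac)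
    qed
    note mehler = mehler_product[OF h01 h2 theta_series_recurrence_0[OF q] theta_series_recurrence[OF q],
        of t, folded a_def, OF growth q \<rho>, folded P_def S_def]
    have X2: "(1 - q) * x\<^sup>2 = 4 * (cos t)\<^sup>2" and Y2: "(1 - q) * y\<^sup>2 = 4 * (cos s)\<^sup>2"
      and XY: "(1 - q) * (x * y) = ?X * ?Y"
      using arg_cong[OF t, of power2] arg_cong[OF s, of power2] arg_cong2[OF t s, of times] w(2)
      by (simp_all add: power_mult_distrib power2_eq_square mult_ac)
    have num: "(1 + q ^ k)\<^sup>2 - (1 - q) * x\<^sup>2 * q ^ k = N k" for k
      by (simp add: X2 N_def)
    have den: "(1 - \<rho>\<^sup>2 * q ^ (2 * k))\<^sup>2 - (1 - q) * \<rho> * q ^ k * (1 + \<rho>\<^sup>2 * q ^ (2 * k)) * x * y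
        + (1 - q) * \<rho>\<^sup>2 * (x\<^sup>2 + y\<^sup>2) * q ^ (2 * k) = P (\<rho> * q ^ k)" for k
    proof -
      define r where "r = \<rho> * q ^ k"
      have "q ^ (2 * k) = q ^ k * q ^ k" by (simp add: mult_2 power_add)
      then have "(1 - \<rho>\<^sup>2 * q ^ (2 * k))\<^sup>2 - (1 - q) * \<rho> * q ^ k * (1 + \<rho>\<^sup>2 * q ^ (2 * k)) * x * y
        + (1 - q) * \<rho>\<^sup>2 * (x\<^sup>2 + y\<^sup>2) * q ^ (2 * k) =
        (1 - r\<^sup>2)\<^sup>2 - r * (1 + r\<^sup>2) * ((1 - q) * (x * y)) + r\<^sup>2 * ((1 - q) * x\<^sup>2 + (1 - q) * y\<^sup>2)"
        by (simp add: r_def algebra_simps power2_eq_square)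
      also have "\<dots> = P r"
        unfolding XY X2 Y2 P_def by (simp add: algebra_simps eval_nat_numeral)
      finally show ?thesis by (simp add: r_def)
    qed
    have Nbound: "\<bar>N k - 1\<bar> \<le> 7 * \<bar>q\<bar> ^ k" for k
      unfolding N_def by (rule theta_factor_bound[OF q]) simp
    have convN: "convergent_prod N"
      using Nbound q by (rule convergent_prod_geometric)
    have Pnz: "prodinf (\<lambda>k. P (\<rho> * q ^ k)) \<noteq> 0"
    proof (rule prodinf_nonzero[OF mehler(1)])
      fix k
      have "\<bar>\<rho>\<bar> * \<bar>q\<bar> ^ k \<le> \<bar>\<rho>\<bar> * 1" using q by (intro mult_left_mono power_le_one) auto
      then have "\<bar>\<rho> * q ^ k\<bar> < 1" using \<rho> by (simp add: abs_mult power_abs)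
      from mehler_denominator_pos[OF this] show "P (\<rho> * q ^ k) \<noteq> 0"
        unfolding P_def by (metis less_irrefl)
    qed
    have N0: "N 0 = 4 - (1 - q) * x\<^sup>2" by (simp add: N_def X2)
    have a0: "a 0 = q_poch_inf q q * (\<Prod>k. N (Suc k))"
      unfolding a_def N_def theta_series_eq_product[OF q, symmetric] theta_series_def using q by simp
    have "S = q_poch_inf q (\<rho>\<^sup>2) * a 0 / (\<Prod>k. P (\<rho> * q ^ k))"
      using mehler(2) Pnz by (simp add: eq_divide_eq mult.commute)
    \<comment> \<open>The triple product in \<open>a 0\<close> starts at index 1, so the factor of
      index 0 is split off; away from the endpoints it is nonzero.\<close>
    moreover have "prodinf N = N 0 * (\<Prod>k. N (Suc k))"
      using prodinf_split_initial_segment[OF convN, of 1] False N0 by simp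
    moreover have "(\<Prod>k. N k / P (\<rho> * q ^ k)) = prodinf N / prodinf (\<lambda>k. P (\<rho> * q ^ k))"
      by (rule prodinf_divide[symmetric, OF convN mehler(1)])
    ultimately have "q_poch_inf q (\<rho>\<^sup>2) * q_poch_inf q q * (\<Prod>k. N k / P (\<rho> * q ^ k)) = N 0 * S"
      unfolding a0 by simp
    moreover have "N 0 > 0"
      using False N0 X2 abs_square_le_1[of "cos t"] by simp
    moreover have "f_U x q = ?w * sqrt (N 0) / (2 * pi)"
      unfolding f_U_def N0 by (simp add: real_sqrt_mult)
    moreover have "f_CN x y \<rho> q = ?w / (2 * pi * sqrt (N 0))
        * (q_poch_inf q (\<rho>\<^sup>2) * q_poch_inf q q * (\<Prod>k. N k / P (\<rho> * q ^ k)))"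
      unfolding f_CN_def num den N0 by simp
    ultimately have "f_CN x y \<rho> q = ?w / (2 * pi) * (N 0 / sqrt (N 0)) * S" by simp
    \<comment> \<open>The extra factor \<open>N 0\<close> moves the square root from the denominator
      of \<open>f_CN\<close> to the numerator, where \<open>f_U\<close> has it.\<close>
    also have "N 0 / sqrt (N 0) = sqrt (N 0)" using \<open>N 0 > 0\<close> by (simp add: real_div_sqrt)
    finally show ?thesis using \<open>f_U x q = _\<close> by simp
  qed
  with summ S_eq show ?thesis unfolding ct by simp
qed

end
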